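(* Let $n\ge 6$ and let $G$ be a connected simple graph with $n$ vertices and $n+1$ edges in which two cycles $C_p$ and $C_q$ share exactly one common vertex (i.e. $G\in\mathcal{B}(p,q)$). If $G\not\cong R_n(3,3)$, then $\operatorname{avm}(G)>\operatorname{avm}(R_n(3,3))$.
   Context: $\operatorname{avm}(G)$ is the average of $|M|$ over all maximal matchings $M$ of $G$ (a matching is maximal if not properly contained in another matching). $R_n(3,3)$ is the graph obtained from two triangles $uv_1v_2$ and $uw_1w_2$ sharing exactly the vertex $u$ by attaching $n-5\ge1$ pendant edges (new leaves) to the vertex $v_1$. *)

theory Defs
  imports Complex_Main
begin

text \<open>Finite simple graphs: vertex set V, edge set E of 2-element subsets of V.\<close>
definition simple_graph :: "'a set \<Rightarrow> 'a set set \<Rightarrow> bool" where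
  "simple_graph V E \<longleftrightarrow> finite V \<and> (\<forall>e\<in>E. e \<subseteq> V \<and> card e = 2)"

definition connected_graph :: "'a set \<Rightarrow> 'a set set \<Rightarrow> bool" where
  "connected_graph V E \<longleftrightarrow>
     (\<forall>u\<in>V. \<forall>v\<in>V. (u, v) \<in> {(x, y). {x, y} \<in> E}\<^sup>*)"

text \<open>A cycle: a list of k >= 3 distinct vertices, consecutive ones (cyclically) adjacent.\<close>
definition is_cycle :: "'a set set \<Rightarrow> 'a list \<Rightarrow> bool" where
  "is_cycle E c \<longleftrightarrow> length c \<ge> 3 \<and> distinct c \<and>
     (\<forall>i < length c. {c ! i, c ! ((i + 1) mod length c)} \<in> E)"

definition is_matching :: "'a set set \<Rightarrow> 'a set set \<Rightarrow> bool" where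
  "is_matching E M \<longleftrightarrow> M \<subseteq> E \<and> (\<forall>e1\<in>M. \<forall>e2\<in>M. e1 \<noteq> e2 \<longrightarrow> e1 \<inter> e2 = {})"

definition maximal_matching :: "'a set set \<Rightarrow> 'a set set \<Rightarrow> bool" where
  "maximal_matching E M \<longleftrightarrow> is_matching E M \<and>
     (\<forall>M'. is_matching E M' \<and> M \<subseteq> M' \<longrightarrow> M' = M)"

text \<open>Average size of a maximal matching.\<close>
definition avm :: "'a set set \<Rightarrow> real" where
  "avm E = (\<Sum>M\<in>{M. maximal_matching E M}. real (card M))
            / real (card {M. maximal_matching E M})"

definition graph_iso :: "'a set \<Rightarrow> 'a set set \<Rightarrow> 'b set \<Rightarrow> 'b set set \<Rightarrow> bool" where
  "graph_iso V1 E1 V2 E2 \<longleftrightarrow> (\<exists>f. bij_betw f V1 V2 \<and>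
     (\<forall>u\<in>V1. \<forall>v\<in>V1. {u, v} \<in> E1 \<longleftrightarrow> {f u, f v} \<in> E2))"

text \<open>R_n(3,3): u = 0, v1 = 1, v2 = 2, w1 = 3, w2 = 4, pendant leaves 5..n-1 attached to v1.\<close>
definition R_V :: "nat \<Rightarrow> nat set" where
  "R_V n = {..<n}"

definition R_E :: "nat \<Rightarrow> nat set set" where
  "R_E n = {{0, 1}, {0, 2}, {1, 2}, {0, 3}, {0, 4}, {3, 4}} \<union> {{1, k} | k. 5 \<le> k \<and> k < n}"

end

theory Submission
  imports Defs
begin

text \<open>Let \<open>u\<close> be the common vertex of the two cycles, \<open>k = n - 5\<close>, and give a maximal matching
  the weight -1 if it has size 2 and the weight 2 otherwise. All maximal matchings have size at
  least 2 and \<open>avm (R_E n) = (7 k + 8) / (3 k + 4) < 7 / 3\<close>, so it is enough that the total weight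
  is nonnegative. Split the maximal matchings by the partner \<open>v\<close> of \<open>u\<close>. Those with partner \<open>v\<close>
  correspond to the maximal matchings of the forest \<open>G - u - v\<close>, and they contribute at least 1
  unless this forest is a star: two distinct single edges that both dominate it would force a
  triangle. Those missing \<open>u\<close> contribute at least -3, which the at least four neighbours of \<open>u\<close>
  compensate. If some \<open>G - u - v\<close> is a star, then \<open>G - u\<close> consists of two stars and isolated
  vertices, and the total weight can be computed. It is negative only for \<open>R_n(3,3)\<close> and for two
  triangles with a single leaf at \<open>u\<close>, whose average is 11/5.\<close>

section \<open>Edge sets, vertex deletion and sums over maximal matchings\<close>

definition edge_set :: "'a set set \<Rightarrow> bool" where
  "edge_set E \<longleftrightarrow> finite E \<and> (\<forall>e\<in>E. card e = 2)"

text \<open>Vertex deletion without a vertex set: \<open>avm\<close> depends on edges only, so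
  isolated vertices left over in \<open>G - u - v\<close> need no bookkeeping.\<close>

definition avoid :: "'a set set \<Rightarrow> 'a \<Rightarrow> 'a set set" where
  "avoid E v = {e\<in>E. v \<notin> e}"

definition star :: "'a \<Rightarrow> 'a set \<Rightarrow> 'a set set" where
  "star v B = (\<lambda>b. {v, b}) ` B"

definition nbrs :: "'a set set \<Rightarrow> 'a \<Rightarrow> 'a set" where
  "nbrs E v = {x. {v, x} \<in> E}"

text \<open>The function \<open>h\<close> of the size is a parameter so that one formula serves
  three purposes: \<open>h = real\<close> and \<open>h = 1\<close> give numerator and denominator of
  \<open>avm\<close>, and \<open>h = wt\<close> gives the total weight.\<close>

definition mm_sum :: "(nat \<Rightarrow> real) \<Rightarrow> 'a set set \<Rightarrow> real" where
  "mm_sum h E = (\<Sum>M | maximal_matching E M. h (card M))"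

definition mm_sum_missing :: "(nat \<Rightarrow> real) \<Rightarrow> 'a set set \<Rightarrow> 'a \<Rightarrow> real" where
  "mm_sum_missing h E v = (\<Sum>M | maximal_matching E M \<and> v \<notin> \<Union>M. h (card M))"

lemma edge_set_avoid: "edge_set E \<Longrightarrow> edge_set (avoid E v)"
  by (auto simp: edge_set_def avoid_def)

lemma edge_set_nbr_neq: "edge_set E \<Longrightarrow> {v, x} \<in> E \<Longrightarrow> v \<noteq> x"
  by (auto simp: edge_set_def)

lemma nbrs_irrefl: "edge_set E \<Longrightarrow> v \<notin> nbrs E v"
  by (auto simp: edge_set_def nbrs_def)

lemma edge_set_obtain:
  assumes "edge_set E" "e \<in> E" "v \<in> e"
  obtains x where "e = {v, x}" "x \<noteq> v"
proof -
  have "card e = 2" using assms by (auto simp: edge_set_def)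
  then obtain a b where "e = {a, b}" "a \<noteq> b" by (auto simp: card_2_iff)
  with assms(3) that show thesis by (cases "v = a") (auto simp: insert_commute)
qed

lemma finite_nbrs: "edge_set E \<Longrightarrow> finite (nbrs E v)"
proof -
  assume E: "edge_set E"
  have "inj_on (\<lambda>x. {v, x}) (nbrs E v)" by (auto simp: inj_on_def doubleton_eq_iff)
  moreover have "(\<lambda>x. {v, x}) ` nbrs E v \<subseteq> E" by (auto simp: nbrs_def)
  ultimately show ?thesis
    using E inj_on_finite[of _ "nbrs E v" E] by (auto simp: edge_set_def)
qed

text \<open>An edge meeting no member of \<open>M\<close> could be added to \<open>M\<close>;
  conversely, an edge of a strictly larger matching outside \<open>M\<close> is disjoint from all of
  \<open>M\<close>. This domination criterion is local and replaces the quantifier over all larger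
  matchings from here on.\<close>

lemma maximal_matching_iff:
  assumes "edge_set E"
  shows "maximal_matching E M \<longleftrightarrow> is_matching E M \<and> (\<forall>e\<in>E. \<exists>f\<in>M. e \<inter> f \<noteq> {})"
proof safe
  assume mm: "maximal_matching E M"
  then show m: "is_matching E M" by (simp add: maximal_matching_def)
  fix e assume e: "e \<in> E"
  have ne: "e \<noteq> {}" using assms e by (auto simp: edge_set_def)
  show "\<exists>f\<in>M. e \<inter> f \<noteq> {}"
  proof (rule ccontr)
    assume "\<not> (\<exists>f\<in>M. e \<inter> f \<noteq> {})"
    then have d: "\<And>f. f \<in> M \<Longrightarrow> e \<inter> f = {}" by blast
    have "is_matching E (insert e M)"
      using m e d unfolding is_matching_def by blast
    then have "insert e M = M" using mm unfolding maximal_matching_def by blast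
    then show False using d[of e] ne by auto
  qed
next
  assume m: "is_matching E M" and c: "\<forall>e\<in>E. \<exists>f\<in>M. e \<inter> f \<noteq> {}"
  have "M' = M" if M': "is_matching E M'" "M \<subseteq> M'" for M'
  proof (rule ccontr)
    assume "M' \<noteq> M"
    then obtain e where e: "e \<in> M'" "e \<notin> M" using M'(2) by blast
    have "e \<in> E" using e M'(1) by (auto simp: is_matching_def)
    then obtain f where "f \<in> M" "e \<inter> f \<noteq> {}" using c by blast
    moreover have "f \<in> M'" "e \<noteq> f" using M'(2) \<open>f \<in> M\<close> e by auto
    ultimately show False using e(1) M'(1) unfolding is_matching_def by blast
  qed
  then show "maximal_matching E M" using m unfolding maximal_matching_def by blast
qed

lemma maximal_matching_subset: "maximal_matching E M \<Longrightarrow> M \<subseteq> E"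
  by (simp add: maximal_matching_def is_matching_def)

lemma maximal_matching_disjoint:
  "maximal_matching E M \<Longrightarrow> e \<in> M \<Longrightarrow> f \<in> M \<Longrightarrow> v \<in> e \<Longrightarrow> v \<in> f \<Longrightarrow> e = f"
  unfolding maximal_matching_def is_matching_def by blast

lemma finite_maximal_matchings: "edge_set E \<Longrightarrow> finite {M. maximal_matching E M}"
  by (rule finite_subset[of _ "Pow E"])
     (auto simp: edge_set_def dest: maximal_matching_subset)

lemma is_matching_extend_maximal:
  assumes "edge_set E" "is_matching E M"
  obtains M' where "maximal_matching E M'" "M \<subseteq> M'"
proof -
  let ?A = "{M'. is_matching E M' \<and> M \<subseteq> M'}"
  have "finite ?A"
    by (rule finite_subset[of _ "Pow E"]) (use assms in \<open>auto simp: is_matching_def edge_set_def\<close>)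
  moreover have "?A \<noteq> {}" using assms by auto
  ultimately obtain M' where M': "M' \<in> ?A" "\<And>X. X \<in> ?A \<Longrightarrow> M' \<subseteq> X \<Longrightarrow> X = M'"
    using finite_has_maximal[of ?A] by (metis (no_types, lifting))
  then have "maximal_matching E M'" unfolding maximal_matching_def by auto
  then show thesis using that M' by auto
qed

text \<open>The edge \<open>{u, x}\<close> dominates exactly the edges through \<open>u\<close> or
  \<open>x\<close>. The other members of the matching must avoid both ends and dominate precisely
  what is left after deleting them.\<close>

lemma maximal_matching_insert_iff:
  assumes E: "edge_set E" and e: "{u, x} \<in> E" and N: "{u, x} \<notin> N"
  shows "maximal_matching E (insert {u, x} N) \<longleftrightarrow> maximal_matching (avoid (avoid E u) x) N"
proof -
  let ?F = "avoid (avoid E u) x"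
  have F: "edge_set ?F" using E by (simp add: edge_set_avoid)
  have "is_matching E (insert {u, x} N) \<longleftrightarrow> is_matching ?F N"
  proof
    assume m: "is_matching E (insert {u, x} N)"
    have "u \<notin> f \<and> x \<notin> f \<and> f \<in> E" if f: "f \<in> N" for f
    proof -
      have "f \<noteq> {u, x}" using f N by blast
      then have "f \<inter> {u, x} = {}" "f \<in> E" using m f unfolding is_matching_def by auto
      then show ?thesis by simp
    qed
    then have "N \<subseteq> ?F" by (auto simp: avoid_def)
    then show "is_matching ?F N" using m by (simp add: is_matching_def)
  next
    assume m: "is_matching ?F N"
    then have N': "N \<subseteq> ?F" by (simp add: is_matching_def)
    then have "f \<inter> {u, x} = {} \<and> {u, x} \<inter> f = {}" if "f \<in> N" for f
      using that by (auto simp: avoid_def)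
    moreover have "N \<subseteq> E" using N' by (auto simp: avoid_def)
    ultimately show "is_matching E (insert {u, x} N)"
      using m e by (simp add: is_matching_def)
  qed
  moreover have "(\<exists>f\<in>insert {u, x} N. e \<inter> f \<noteq> {}) \<longleftrightarrow>
      u \<in> e \<or> x \<in> e \<or> (\<exists>f\<in>N. e \<inter> f \<noteq> {})" for e by simp
  then have "(\<forall>e\<in>E. \<exists>f\<in>insert {u, x} N. e \<inter> f \<noteq> {}) \<longleftrightarrow> (\<forall>e\<in>?F. \<exists>f\<in>N. e \<inter> f \<noteq> {})"
    by (simp only: avoid_def mem_Collect_eq) blast
  ultimately show ?thesis
    unfolding maximal_matching_iff[OF E] maximal_matching_iff[OF F] by simp
qed

text \<open>Adding \<open>{u, x}\<close> is a bijection that raises the size by one, hence the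
  shifted argument of \<open>h\<close>.\<close>

lemma mm_sum_with_edge:
  assumes E: "edge_set E" and e: "{u, x} \<in> E"
  shows "(\<Sum>M | maximal_matching E M \<and> {u, x} \<in> M. h (card M))
         = mm_sum (\<lambda>c. h (Suc c)) (avoid (avoid E u) x)"
proof -
  let ?F = "avoid (avoid E u) x"
  have notin: "{u, x} \<notin> N" if "maximal_matching ?F N" for N
    using maximal_matching_subset[OF that] by (auto simp: avoid_def)
  have fin: "finite N" if "maximal_matching ?F N" for N
    using maximal_matching_subset[OF that] edge_set_avoid[OF edge_set_avoid[OF E]]
    by (auto simp: edge_set_def intro: rev_finite_subset)
  have "bij_betw (insert {u, x}) {N. maximal_matching ?F N}
          {M. maximal_matching E M \<and> {u, x} \<in> M}"
  proof (rule bij_betw_imageI)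
    show "inj_on (insert {u, x}) {N. maximal_matching ?F N}"
      using notin by (intro inj_onI) (metis insert_ident mem_Collect_eq)
    show "insert {u, x} ` {N. maximal_matching ?F N} = {M. maximal_matching E M \<and> {u, x} \<in> M}"
    proof safe
      fix N assume "maximal_matching ?F N"
      then show "maximal_matching E (insert {u, x} N)"
        using maximal_matching_insert_iff[OF E e] notin by blast
    next
      fix M assume M: "maximal_matching E M" "{u, x} \<in> M"
      then have "M = insert {u, x} (M - {{u, x}})" by auto
      moreover have "maximal_matching ?F (M - {{u, x}})"
        using maximal_matching_insert_iff[OF E e, of "M - {{u, x}}"] M by (simp add: insert_absorb)
      ultimately show "M \<in> insert {u, x} ` {N. maximal_matching ?F N}" by blast
    qed
  qed
  then have "(\<Sum>M | maximal_matching E M \<and> {u, x} \<in> M. h (card M))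
      = (\<Sum>N | maximal_matching ?F N. h (card (insert {u, x} N)))"
    by (rule sum.reindex_bij_betw[symmetric])
  also have "\<dots> = mm_sum (\<lambda>c. h (Suc c)) ?F"
    unfolding mm_sum_def using notin fin by (intro sum.cong) auto
  finally show ?thesis .
qed

text \<open>A matching covers \<open>u\<close> by at most one edge, so the maximal matchings are
  partitioned by the partner \<open>x\<close> of \<open>u\<close>, with one further class for those
  that miss \<open>u\<close>. This is the recursion behind all later evaluations and
  estimates.\<close>

lemma mm_sum_decompose:
  assumes E: "edge_set E"
  shows "mm_sum h E = (\<Sum>x\<in>nbrs E u. mm_sum (\<lambda>c. h (Suc c)) (avoid (avoid E u) x))
                      + mm_sum_missing h E u"
proof -
  let ?A = "\<lambda>x. {M. maximal_matching E M \<and> {u, x} \<in> M}"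
  let ?B = "{M. maximal_matching E M \<and> u \<notin> \<Union>M}"
  have finA: "finite (?A x)" for x
    by (rule finite_subset[OF _ finite_maximal_matchings[OF E]]) auto
  have finB: "finite ?B"
    by (rule finite_subset[OF _ finite_maximal_matchings[OF E]]) auto
  have eq: "{M. maximal_matching E M} = (\<Union>x\<in>nbrs E u. ?A x) \<union> ?B"
  proof (intro subset_antisym subsetI)
    fix M assume M: "M \<in> {M. maximal_matching E M}"
    show "M \<in> (\<Union>x\<in>nbrs E u. ?A x) \<union> ?B"
    proof (cases "u \<in> \<Union>M")
      case True
      then obtain e where e: "e \<in> M" "u \<in> e" by blast
      then have "e \<in> E" using M maximal_matching_subset by blast
      then obtain x where "e = {u, x}" using edge_set_obtain[OF E _ e(2)] by metis
      then show ?thesis using e M \<open>e \<in> E\<close> by (auto simp: nbrs_def)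
    qed (use M in auto)
  qed auto
  have disj: "?A x \<inter> ?A y = {}" if "x \<noteq> y" for x y
  proof -
    have "{u, x} \<noteq> {u, y}" using that by (simp add: doubleton_eq_iff)
    then show ?thesis using maximal_matching_disjoint[of E _ "{u, x}" "{u, y}" u] by blast
  qed
  have "mm_sum h E = (\<Sum>M\<in>(\<Union>x\<in>nbrs E u. ?A x). h (card M)) + (\<Sum>M\<in>?B. h (card M))"
    unfolding mm_sum_def eq using finA finB finite_nbrs[OF E]
    by (intro sum.union_disjoint) auto
  also have "(\<Sum>M\<in>(\<Union>x\<in>nbrs E u. ?A x). h (card M)) = (\<Sum>x\<in>nbrs E u. \<Sum>M\<in>?A x. h (card M))"
    using finA disj finite_nbrs[OF E] by (intro sum.UNION_disjoint) auto
  also have "\<dots> = (\<Sum>x\<in>nbrs E u. mm_sum (\<lambda>c. h (Suc c)) (avoid (avoid E u) x))"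
    using mm_sum_with_edge[OF E] by (intro sum.cong) (auto simp: nbrs_def)
  finally show ?thesis by (simp add: mm_sum_missing_def)
qed

section \<open>Matching sums of unions of stars\<close>

lemma avoid_Un: "avoid (E \<union> F) v = avoid E v \<union> avoid F v"
  by (auto simp: avoid_def)

lemma avoid_star: "avoid (star x B) v = (if v = x then {} else star x (B - {v}))"
  by (auto simp: avoid_def star_def)

lemma edge_set_star: "finite B \<Longrightarrow> x \<notin> B \<Longrightarrow> edge_set (star x B)"
  by (auto simp: edge_set_def star_def card_2_iff)

lemma edge_set_Un: "edge_set (E \<union> F) \<longleftrightarrow> edge_set E \<and> edge_set F"
  by (auto simp: edge_set_def)

lemma mem_star: "e \<in> star v B \<longleftrightarrow> (\<exists>b\<in>B. e = {v, b})"
  by (auto simp: star_def)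

lemma pair_mem_star [simp]: "{v, b} \<in> star v B \<longleftrightarrow> b \<in> B"
  by (auto simp: mem_star doubleton_eq_iff)

lemma finite_star: "finite B \<Longrightarrow> finite (star v B)"
  by (simp add: star_def)

lemma card_star: "card (star v B) = card B"
  unfolding star_def by (rule card_image) (auto simp: inj_on_def doubleton_eq_iff)

lemma star_empty [simp]: "star x {} = {}"
  by (simp add: star_def)

lemma avoid_empty [simp]: "avoid {} v = {}"
  by (simp add: avoid_def)

lemma mm_sum_empty: "mm_sum h {} = h 0"
proof -
  have "{M. maximal_matching {} M} = {{} :: 'a set set}"
    unfolding maximal_matching_def is_matching_def by blast
  then show ?thesis by (simp add: mm_sum_def)
qed

text \<open>If \<open>b\<close> has no neighbour except \<open>x\<close>, only an edge through
  \<open>x\<close> can dominate \<open>{x, b}\<close>, so no maximal matching misses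
  \<open>x\<close>.\<close>

lemma mm_sum_missing_private_nbr:
  assumes E: "edge_set E" and b: "{x, b} \<in> E" "\<And>e. e \<in> E \<Longrightarrow> b \<in> e \<Longrightarrow> e = {x, b}"
  shows "mm_sum_missing h E x = 0"
proof -
  have "\<not> (maximal_matching E M \<and> x \<notin> \<Union>M)" for M
  proof
    assume M: "maximal_matching E M \<and> x \<notin> \<Union>M"
    then obtain f where "f \<in> M" "{x, b} \<inter> f \<noteq> {}"
      using b(1) unfolding maximal_matching_iff[OF E] by blast
    moreover have "f \<in> E" using M \<open>f \<in> M\<close> maximal_matching_subset by blast
    ultimately show False using b(2)[of f] M by auto
  qed
  then have "{M. maximal_matching E M \<and> x \<notin> \<Union>M} = {}" by blast
  then show ?thesis unfolding mm_sum_missing_def by (simp only: sum.empty)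
qed

lemma mm_sum_star:
  fixes h :: "nat \<Rightarrow> real"
  assumes "finite B" "x \<notin> B" "B \<noteq> {}"
  shows "mm_sum h (star x B) = card B * h 1"
proof -
  have E: "edge_set (star x B)" using assms by (simp add: edge_set_star)
  obtain b where "b \<in> B" using assms by auto
  then have "mm_sum_missing h (star x B) x = 0"
    using assms by (intro mm_sum_missing_private_nbr[OF E, of _ b]) (auto simp: star_def)
  moreover have "nbrs (star x B) x = B"
    using assms by (auto simp: nbrs_def star_def doubleton_eq_iff)
  ultimately show ?thesis
    using mm_sum_decompose[OF E, of h x] by (simp add: avoid_star mm_sum_empty)
qed

text \<open>A maximal matching takes exactly one edge from each star, independently.\<close>

lemma mm_sum_two_stars:
  fixes h :: "nat \<Rightarrow> real"
  assumes "finite B" "finite C" "x \<noteq> z" "x \<notin> B \<union> C" "z \<notin> B \<union> C" "B \<inter> C = {}"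
    "B \<noteq> {}" "C \<noteq> {}"
  shows "mm_sum h (star x B \<union> star z C) = card B * card C * h 2"
proof -
  let ?E = "star x B \<union> star z C"
  have E: "edge_set ?E" using assms by (simp add: edge_set_Un edge_set_star)
  obtain b where "b \<in> B" using assms by auto
  then have "mm_sum_missing h ?E x = 0"
    using assms by (intro mm_sum_missing_private_nbr[OF E, of _ b]) (auto simp: star_def)
  moreover have "nbrs ?E x = B"
    using assms by (auto simp: nbrs_def star_def doubleton_eq_iff)
  moreover have "mm_sum (\<lambda>c. h (Suc c)) (avoid (avoid ?E x) v) = card C * h 2" if "v \<in> B" for v
  proof -
    have "avoid (avoid ?E x) v = star z C"
    proof -
      have "C - {x} = C" "C - {v} = C" "v \<noteq> z" using assms that by auto
      then show ?thesis using assms by (simp add: avoid_Un avoid_star)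
    qed
    then show ?thesis using mm_sum_star[of C z "\<lambda>c. h (Suc c)"] assms
      by (simp add: numeral_2_eq_2)
  qed
  ultimately show ?thesis using mm_sum_decompose[OF E, of h x] by simp
qed

text \<open>The sum of \<open>h\<close> over the maximal matchings, enlarged by one edge, of two disjoint stars with
  \<open>p\<close> and \<open>q\<close> edges; a star with no edges contributes nothing. The value at \<open>p = q = 0\<close> is junk.\<close>
definition pair_val :: "(nat \<Rightarrow> real) \<Rightarrow> nat \<Rightarrow> nat \<Rightarrow> real" where
  "pair_val h p q = (if p = 0 then q * h 2 else if q = 0 then p * h 2 else p * q * h 3)"

lemma mm_sum_star_pair:
  fixes h :: "nat \<Rightarrow> real"
  assumes "finite B" "finite C" "x \<noteq> z" "x \<notin> B \<union> C" "z \<notin> B \<union> C" "B \<inter> C = {}"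
    "B \<noteq> {} \<or> C \<noteq> {}"
  shows "mm_sum (\<lambda>c. h (Suc c)) (star x B \<union> star z C) = pair_val h (card B) (card C)"
proof -
  consider "B = {}" "C \<noteq> {}" | "C = {}" "B \<noteq> {}" | "B \<noteq> {}" "C \<noteq> {}" using assms by auto
  then show ?thesis
  proof cases
    case 1
    then show ?thesis using mm_sum_star[of C z "\<lambda>c. h (Suc c)"] assms
      by (simp add: pair_val_def numeral_2_eq_2)
  next
    case 2
    then show ?thesis using mm_sum_star[of B x "\<lambda>c. h (Suc c)"] assms
      by (simp add: pair_val_def numeral_2_eq_2)
  next
    case 3
    then show ?thesis using mm_sum_two_stars[of B C x z "\<lambda>c. h (Suc c)"] assms
      by (simp add: pair_val_def numeral_3_eq_3 numeral_2_eq_2)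
  qed
qed

text \<open>Deleting \<open>u\<close> and its partner \<open>v\<close> leaves two disjoint stars: a
  star disappears if \<open>v\<close> is its centre and loses an edge if \<open>v\<close> is one of
  its leaves. The set \<open>N\<close> may contain \<open>x\<close>, \<open>z\<close> and members of
  \<open>P\<close> and \<open>Q\<close>, which is how cycles through \<open>u\<close> arise.\<close>

lemma mm_sum_three_stars:
  fixes h :: "nat \<Rightarrow> real"
  assumes fin: "finite N" "finite P" "finite Q"
    and neq: "u \<noteq> x" "u \<noteq> z" "x \<noteq> z"
    and notin: "u \<notin> N \<union> P \<union> Q" "x \<notin> P \<union> Q" "z \<notin> P \<union> Q"
    and PQ: "P \<inter> Q = {}" "P \<noteq> {}" "Q \<noteq> {}"
    and E: "E = star u N \<union> star x P \<union> star z Q"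
  shows "mm_sum h E =
    (\<Sum>v\<in>N. pair_val h (if v = x then 0 else card (P - {v})) (if v = z then 0 else card (Q - {v})))
    + mm_sum_missing h E u"
proof -
  have es: "edge_set E" unfolding E using fin notin by (simp add: edge_set_Un edge_set_star)
  have nb: "nbrs E u = N"
    unfolding E nbrs_def star_def using neq notin by (auto simp: doubleton_eq_iff)
  have "mm_sum (\<lambda>c. h (Suc c)) (avoid (avoid E u) v) =
      pair_val h (if v = x then 0 else card (P - {v})) (if v = z then 0 else card (Q - {v}))"
    if "v \<in> N" for v
  proof -
    have "avoid (avoid E u) v = star x (if v = x then {} else P - {v}) \<union> star z (if v = z then {} else Q - {v})"
      unfolding E using neq notin by (auto simp: avoid_Un avoid_star)
    \<comment> \<open>One vertex \<open>v\<close> cannot destroy both stars, since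
      \<open>insert x P\<close> and \<open>insert z Q\<close> are disjoint. This keeps away from the
      junk value of \<open>pair_val\<close>.\<close>
    moreover have "(if v = x then {} else P - {v}) \<noteq> {} \<or> (if v = z then {} else Q - {v}) \<noteq> {}"
      using PQ neq notin by auto
    moreover have "(if v = x then {} else P - {v}) \<inter> (if v = z then {} else Q - {v}) = {}"
      using PQ by auto
    ultimately show ?thesis
      using mm_sum_star_pair[of "if v = x then {} else P - {v}" "if v = z then {} else Q - {v}" x z h]
        fin neq notin by (simp add: if_distrib[of card])
  qed
  then show ?thesis using mm_sum_decompose[OF es, of h u] nb by simp
qed

section \<open>Two triangles, or a triangle and a 4-cycle, sharing \<open>u\<close>, with leaves
  \<open>A\<close>, \<open>B\<close>, \<open>C\<close> at \<open>u\<close>, \<open>x\<close>,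
  \<open>z\<close>\<close>

definition two_triangles where
  "two_triangles u x y z w A B C E \<longleftrightarrow>
     distinct [u, x, y, z, w] \<and> finite A \<and> finite B \<and> finite C \<and>
     {u, x, y, z, w} \<inter> (A \<union> B \<union> C) = {} \<and> A \<inter> B = {} \<and> A \<inter> C = {} \<and> B \<inter> C = {} \<and>
     E = star u ({x, y, z, w} \<union> A) \<union> star x (insert y B) \<union> star z (insert w C)"

text \<open>The triangle is \<open>u x y\<close>, and the 4-cycle is \<open>u w z w'\<close>, with
  \<open>z\<close> opposite to \<open>u\<close>. In \<open>two_triangles\<close> the second cycle is
  instead the triangle \<open>u z w\<close>.\<close>

definition triangle_square where
  "triangle_square u x y z w w' A B C E \<longleftrightarrow>
     distinct [u, x, y, z, w, w'] \<and> finite A \<and> finite B \<and> finite C \<and>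
     {u, x, y, z, w, w'} \<inter> (A \<union> B \<union> C) = {} \<and> A \<inter> B = {} \<and> A \<inter> C = {} \<and> B \<inter> C = {} \<and>
     E = star u ({x, y, w, w'} \<union> A) \<union> star x (insert y B) \<union> star z ({w, w'} \<union> C)"

text \<open>The summands belong in this order to the partners \<open>x\<close>, \<open>y\<close>,
  \<open>z\<close>, \<open>w\<close> of \<open>u\<close>, to the leaves in \<open>A\<close> as
  partners, and to the matchings that miss \<open>u\<close>.\<close>

lemma mm_sum_two_triangles:
  fixes h :: "nat \<Rightarrow> real"
  assumes "two_triangles u x y z w A B C E"
  shows "mm_sum h E = (card C + 1) * h 2 + pair_val h (card B) (card C + 1)
      + (card B + 1) * h 2 + pair_val h (card B + 1) (card C)
      + card A * ((card B + 1) * (card C + 1) * h 3) + (if A = {} then h 2 else 0)"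
proof -
  have dist: "distinct [u, x, y, z, w]"
    and fin: "finite A" "finite B" "finite C"
    and notin: "{u, x, y, z, w} \<inter> (A \<union> B \<union> C) = {}"
    and disj: "A \<inter> B = {}" "A \<inter> C = {}" "B \<inter> C = {}"
    and E: "E = star u ({x, y, z, w} \<union> A) \<union> star x (insert y B) \<union> star z (insert w C)"
    using assms by (simp_all add: two_triangles_def)
  let ?f = "\<lambda>v. pair_val h (if v = x then 0 else card (insert y B - {v}))
                (if v = z then 0 else card (insert w C - {v}))"
  have neq: "x \<noteq> y" "x \<noteq> z" "x \<noteq> w" "y \<noteq> x" "y \<noteq> z" "y \<noteq> w" "z \<noteq> x" "z \<noteq> y" "z \<noteq> w" "w \<noteq> x" "w \<noteq> y" "w \<noteq> z"
    using dist by auto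
  have es: "edge_set E" unfolding E using dist fin notin by (auto simp: edge_set_Un edge_set_star)
  have miss: "mm_sum_missing h E u = (if A = {} then h 2 else 0)"
  proof (cases "A = {}")
    case False
    then obtain a where a: "a \<in> A" by blast
    have "mm_sum_missing h E u = 0"
    proof (rule mm_sum_missing_private_nbr[OF es])
      show "{u, a} \<in> E" using a by (simp add: E star_def)
      show "e = {u, a}" if "e \<in> E" "a \<in> e" for e
        using that a dist notin disj unfolding E star_def by auto
    qed
    then show ?thesis using False by simp
  next
    case True
    have cases_E: "(\<exists>v\<in>{x, y, z, w}. e = {u, v}) \<or> (\<exists>v\<in>insert y B. e = {x, v}) \<or> (\<exists>v\<in>insert w C. e = {z, v})"
      if "e \<in> E" for e using that True unfolding E Un_iff mem_star by blast
    have inE: "{u, y} \<in> E" "{u, w} \<in> E" "{x, y} \<in> E" "{z, w} \<in> E"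
      unfolding E by simp_all
    \<comment> \<open>With \<open>u\<close> unmatched, dominating \<open>{u, y}\<close> forces
      \<open>{x, y}\<close>, because \<open>x\<close> is the only other neighbour of
      \<open>y\<close>; likewise \<open>{u, w}\<close> forces \<open>{z, w}\<close>. As there are no
      leaves at \<open>u\<close>, these two edges dominate everything.\<close>
    have "{M. maximal_matching E M \<and> u \<notin> \<Union>M} = {{{x, y}, {z, w}}}"
    proof (intro subset_antisym subsetI)
      fix M assume "M \<in> {M. maximal_matching E M \<and> u \<notin> \<Union>M}"
      then have mm: "maximal_matching E M" and uM: "u \<notin> \<Union>M" by auto
      note hit = mm[unfolded maximal_matching_iff[OF es], THEN conjunct2, rule_format]
      note ME = maximal_matching_subset[OF mm]
      have xy: "{x, y} \<in> M"
      proof -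
        obtain f where f: "f \<in> M" "{u, y} \<inter> f \<noteq> {}" using hit[OF inE(1)] by blast
        then have "y \<in> f" "u \<notin> f" using uM by auto
        then have "f = {x, y}" using cases_E[of f] f ME dist notin by auto
        then show ?thesis using f by simp
      qed
      have zw: "{z, w} \<in> M"
      proof -
        obtain f where f: "f \<in> M" "{u, w} \<inter> f \<noteq> {}" using hit[OF inE(2)] by blast
        then have "w \<in> f" "u \<notin> f" using uM by auto
        then have "f = {z, w}" using cases_E[of f] f ME dist notin by auto
        then show ?thesis using f by simp
      qed
      have "f = {x, y} \<or> f = {z, w}" if f: "f \<in> M" for f
      proof -
        have "u \<notin> f" using uM f by blast
        then have "x \<in> f \<or> z \<in> f" using cases_E[of f] f ME by auto
        then show ?thesis
          using maximal_matching_disjoint[OF mm f xy, of x] maximal_matching_disjoint[OF mm f zw, of z]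
          by blast
      qed
      then have "M = {{x, y}, {z, w}}" using xy zw by auto
      then show "M \<in> {{{x, y}, {z, w}}}" by simp
    next
      fix M assume "M \<in> {{{x, y}, {z, w}}}"
      then have M: "M = {{x, y}, {z, w}}" by simp
      have "is_matching E M" using dist inE unfolding M is_matching_def by auto
      moreover have "\<exists>f\<in>M. e \<inter> f \<noteq> {}" if "e \<in> E" for e
        using cases_E[OF that] unfolding M by auto
      ultimately have "maximal_matching E M" by (simp add: maximal_matching_iff[OF es])
      then show "M \<in> {M. maximal_matching E M \<and> u \<notin> \<Union>M}" using dist unfolding M by auto
    qed
    moreover have "card {{x, y}, {z, w}} = 2" using dist by (simp add: doubleton_eq_iff)
    ultimately show ?thesis using True by (simp add: mm_sum_missing_def)
  qed
  have "mm_sum h E = (\<Sum>v\<in>{x, y, z, w} \<union> A. ?f v) + mm_sum_missing h E u"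
    by (rule mm_sum_three_stars[OF _ _ _ _ _ _ _ _ _ _ _ _ E]) (use dist fin notin disj in auto)
  also have "(\<Sum>v\<in>{x, y, z, w} \<union> A. ?f v) = ?f x + ?f y + ?f z + ?f w + (\<Sum>v\<in>A. ?f v)"
    using dist fin notin by (subst sum.union_disjoint) auto
  also have "(\<Sum>v\<in>A. ?f v) = (\<Sum>v\<in>A. (card B + 1) * (card C + 1) * h 3)"
  proof (rule sum.cong)
    fix v assume v: "v \<in> A"
    then have "insert y B - {v} = insert y B" "insert w C - {v} = insert w C" "v \<noteq> x" "v \<noteq> z"
      using notin disj by auto
    then show "?f v = (card B + 1) * (card C + 1) * h 3"
      using notin fin by (simp add: pair_val_def algebra_simps)
  qed simp
  also have "?f x = (card C + 1) * h 2"
  proof -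
    have "insert w C - {x} = insert w C" using dist notin by auto
    then show ?thesis using neq notin fin by (simp add: pair_val_def algebra_simps)
  qed
  also have "?f y = pair_val h (card B) (card C + 1)"
  proof -
    have "insert w C - {y} = insert w C" "insert y B - {y} = B" using dist notin by auto
    then show ?thesis using neq notin fin by simp
  qed
  also have "?f z = (card B + 1) * h 2"
  proof -
    have "insert y B - {z} = insert y B" using dist notin by auto
    then show ?thesis using neq notin fin by (simp add: pair_val_def algebra_simps)
  qed
  also have "?f w = pair_val h (card B + 1) (card C)"
  proof -
    have "insert y B - {w} = insert y B" "insert w C - {w} = C" using dist notin by auto
    then show ?thesis using neq notin fin by simp
  qed
  finally show ?thesis using miss by simp
qed

text \<open>The summands belong to the partners \<open>x\<close> and \<open>y\<close>, to
  \<open>w\<close> and \<open>w'\<close> together, and to the leaves in \<open>A\<close>. There is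
  no term for matchings that miss \<open>u\<close>.\<close>

lemma mm_sum_triangle_square:
  fixes h :: "nat \<Rightarrow> real"
  assumes "triangle_square u x y z w w' A B C E"
  shows "mm_sum h E = (card C + 2) * h 2 + pair_val h (card B) (card C + 2)
      + 2 * ((card B + 1) * (card C + 1) * h 3)
      + card A * ((card B + 1) * (card C + 2) * h 3)"
proof -
  have dist: "distinct [u, x, y, z, w, w']"
    and fin: "finite A" "finite B" "finite C"
    and notin: "{u, x, y, z, w, w'} \<inter> (A \<union> B \<union> C) = {}"
    and disj: "A \<inter> B = {}" "A \<inter> C = {}" "B \<inter> C = {}"
    and E: "E = star u ({x, y, w, w'} \<union> A) \<union> star x (insert y B) \<union> star z ({w, w'} \<union> C)"
    using assms by (simp_all add: triangle_square_def)
  let ?f = "\<lambda>v. pair_val h (if v = x then 0 else card (insert y B - {v}))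
                (if v = z then 0 else card ({w, w'} \<union> C - {v}))"
  have neq: "x \<noteq> y" "x \<noteq> z" "x \<noteq> w" "x \<noteq> w'" "y \<noteq> x" "y \<noteq> z" "y \<noteq> w" "y \<noteq> w'" "z \<noteq> x" "z \<noteq> y" "z \<noteq> w" "z \<noteq> w'" "w \<noteq> x" "w \<noteq> y" "w \<noteq> z" "w \<noteq> w'" "w' \<noteq> x" "w' \<noteq> y" "w' \<noteq> z" "w' \<noteq> w"
    using dist by auto
  have es: "edge_set E" unfolding E using dist fin notin by (auto simp: edge_set_Un edge_set_star)
  have edge_z: "e = {z, v}" if "e \<in> E" "v \<in> e" "u \<notin> e" "v \<in> {w, w'}" for e v
    using that dist notin unfolding E star_def by auto
  \<comment> \<open>The vertices \<open>w\<close> and \<open>w'\<close> have only \<open>u\<close>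
    and \<open>z\<close> as neighbours. If \<open>u\<close> were unmatched, both would have to be
    matched with \<open>z\<close>.\<close>
  have no: "\<not> (maximal_matching E M \<and> u \<notin> \<Union>M)" for M
  proof
    assume M: "maximal_matching E M \<and> u \<notin> \<Union>M"
    have "{z, v} \<in> M" if v: "v \<in> {w, w'}" for v
    proof -
      have "{u, v} \<in> E" using v unfolding E by auto
      then obtain f where f: "f \<in> M" "{u, v} \<inter> f \<noteq> {}"
        using M unfolding maximal_matching_iff[OF es] by blast
      have "f \<in> E" using f M maximal_matching_subset by blast
      have "u \<notin> f" using M f by blast
      then have "v \<in> f" using f by blast
      then show ?thesis using edge_z[OF \<open>f \<in> E\<close> _ \<open>u \<notin> f\<close> v] f by simp
    qed
    then have "{z, w} = {z, w'}" using M maximal_matching_disjoint[of E M "{z, w}" "{z, w'}" z] by blast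
    then show False using dist by (auto simp: doubleton_eq_iff)
  qed
  then have "{M. maximal_matching E M \<and> u \<notin> \<Union>M} = {}" by blast
  then have miss: "mm_sum_missing h E u = 0"
    unfolding mm_sum_missing_def by (simp only: sum.empty)
  have "mm_sum h E = (\<Sum>v\<in>{x, y, w, w'} \<union> A. ?f v) + mm_sum_missing h E u"
    by (rule mm_sum_three_stars[OF _ _ _ _ _ _ _ _ _ _ _ _ E]) (use dist fin notin disj in auto)
  also have "(\<Sum>v\<in>{x, y, w, w'} \<union> A. ?f v) = ?f x + ?f y + ?f w + ?f w' + (\<Sum>v\<in>A. ?f v)"
    using dist fin notin by (subst sum.union_disjoint) auto
  also have "(\<Sum>v\<in>A. ?f v) = (\<Sum>v\<in>A. (card B + 1) * (card C + 2) * h 3)"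
  proof (rule sum.cong)
    fix v assume v: "v \<in> A"
    then have "insert y B - {v} = insert y B" "{w, w'} \<union> C - {v} = insert w (insert w' C)" "v \<noteq> x" "v \<noteq> z"
      using notin disj by auto
    then show "?f v = (card B + 1) * (card C + 2) * h 3"
      using notin fin neq by (simp add: pair_val_def algebra_simps)
  qed simp
  also have "?f x = (card C + 2) * h 2"
  proof -
    have "{w, w'} \<union> C - {x} = insert w (insert w' C)" using dist notin by auto
    then show ?thesis using neq notin fin by (simp add: pair_val_def algebra_simps)
  qed
  also have "?f y = pair_val h (card B) (card C + 2)"
  proof -
    have "{w, w'} \<union> C - {y} = insert w (insert w' C)" "insert y B - {y} = B" using dist notin by auto
    then show ?thesis using neq notin fin by simp
  qed
  also have "?f w = (card B + 1) * (card C + 1) * h 3"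
  proof -
    have "insert y B - {w} = insert y B" "{w, w'} \<union> C - {w} = insert w' C" using dist notin by auto
    then show ?thesis using neq notin fin by (simp add: pair_val_def algebra_simps)
  qed
  also have "?f w' = (card B + 1) * (card C + 1) * h 3"
  proof -
    have "insert y B - {w'} = insert y B" "{w, w'} \<union> C - {w'} = insert w C" using dist notin by auto
    then show ?thesis using neq notin fin by (simp add: pair_val_def algebra_simps)
  qed
  finally show ?thesis using miss by simp
qed

section \<open>Lower bounds for the weight when no \<open>G - u - v\<close> is a star\<close>

lemma disjoint_edges_exist:
  assumes H: "edge_set H" "H \<noteq> {}"
    and nostar: "\<And>z. \<exists>e\<in>H. z \<notin> e"
    and notri: "\<And>a b c. {a, b} \<in> H \<Longrightarrow> {b, c} \<in> H \<Longrightarrow> {a, c} \<in> H \<Longrightarrow> False"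
  shows "\<exists>e\<in>H. \<exists>f\<in>H. e \<inter> f = {}"
proof (rule ccontr)
  assume "\<not> ?thesis"
  then have meet: "e \<inter> f \<noteq> {}" if "e \<in> H" "f \<in> H" for e f using that by blast
  obtain e where e: "e \<in> H" using H by auto
  then obtain a where "a \<in> e" using meet by blast
  then obtain b where ab: "e = {a, b}" "b \<noteq> a" using edge_set_obtain[OF H(1) e] by metis
  \<comment> \<open>Pairwise meeting edges form a star or a triangle: besides \<open>{a, b}\<close>,
    an edge missing \<open>a\<close> has the form \<open>{b, c}\<close>, and an edge missing
    \<open>b\<close> must then be \<open>{a, c}\<close>.\<close>
  obtain e1 where e1: "e1 \<in> H" "a \<notin> e1" using nostar by blast
  then have "b \<in> e1" using meet[OF e e1(1)] ab by auto
  then obtain c where c: "e1 = {b, c}" using edge_set_obtain[OF H(1) e1(1)] by metis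
  obtain e2 where e2: "e2 \<in> H" "b \<notin> e2" using nostar by blast
  then have "a \<in> e2" using meet[OF e e2(1)] ab by auto
  moreover have "c \<in> e2" using meet[OF e1(1) e2(1)] c e2 by auto
  ultimately have "e2 = {a, c}" using edge_set_obtain[OF H(1) e2(1)] e1(2) c
    by (metis insert_iff singletonD)
  then show False using notri[of a b c] e e1 e2 ab c by simp
qed

text \<open>The values are those of \<open>3 * c - 7\<close> at 2 and 3, kept at 2 for larger sizes.
  Since all sizes are at least 2, a nonnegative total weight means an average of at least
  7/3.\<close>

definition wt :: "nat \<Rightarrow> real" where
  "wt c = (if c = 2 then - 1 else 2)"

text \<open>Together with the edge at \<open>u\<close>, a single-edge maximal matching of
  \<open>H\<close> weighs -1 and every other one weighs 2. There is at most one of the first kind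
  and at least one of the second, so the sum is at least 2 - 1.\<close>

lemma mm_sum_wt_ge_1:
  assumes H: "edge_set H" "H \<noteq> {}"
    and nostar: "\<And>z. \<exists>e\<in>H. z \<notin> e"
    and notri: "\<And>a b c. {a, b} \<in> H \<Longrightarrow> {b, c} \<in> H \<Longrightarrow> {a, c} \<in> H \<Longrightarrow> False"
  shows "mm_sum (\<lambda>c. wt (Suc c)) H \<ge> 1"
proof -
  have "\<exists>e\<in>H. \<exists>f\<in>H. e \<inter> f = {}"
    by (rule disjoint_edges_exist[OF H nostar]) (rule notri)
  then obtain g1 g2 where g: "g1 \<in> H" "g2 \<in> H" "g1 \<inter> g2 = {}" by blast
  let ?X = "{M. maximal_matching H M}"
  let ?S = "{M\<in>?X. card M = 1}"
  have finX: "finite ?X" by (rule finite_maximal_matchings[OF H(1)])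
  \<comment> \<open>A dominating edge meets the disjoint edges \<open>g1\<close> and
    \<open>g2\<close>, so it joins an end of one to an end of the other. Two such edges dominate
    each other and share an end; if they differ, they form a triangle with \<open>g1\<close> or with
    \<open>g2\<close>.\<close>
  have uniq: "e = e'" if e: "e \<in> H" "e' \<in> H" "\<And>f. f \<in> H \<Longrightarrow> f \<inter> e \<noteq> {}" "\<And>f. f \<in> H \<Longrightarrow> f \<inter> e' \<noteq> {}"
    for e e'
  proof (rule ccontr)
    assume ne: "e \<noteq> e'"
    obtain c where c: "c \<in> g1" "c \<in> e" using e(3)[OF g(1)] by blast
    obtain d where d: "d \<in> g2" "d \<in> e" using e(3)[OF g(2)] by blast
    have cd: "c \<noteq> d" using c d g(3) by blast
    have ecd: "e = {c, d}" using edge_set_obtain[OF H(1) e(1) c(2)] d(2) cd by (metis insertE singletonD)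
    obtain y where y: "g1 = {c, y}" using edge_set_obtain[OF H(1) g(1) c(1)] by metis
    obtain z where z: "g2 = {d, z}" using edge_set_obtain[OF H(1) g(2) d(1)] by metis
    obtain c' where c': "c' \<in> g1" "c' \<in> e'" using e(4)[OF g(1)] by blast
    obtain d' where d': "d' \<in> g2" "d' \<in> e'" using e(4)[OF g(2)] by blast
    have cd': "c' \<noteq> d'" using c' d' g(3) by blast
    have ecd': "e' = {c', d'}" using edge_set_obtain[OF H(1) e(2) c'(2)] d'(2) cd' by (metis insertE singletonD)
    have "c' = c \<or> c' = y" "d' = d \<or> d' = z" using c' d' y z by auto
    moreover have "c' = c \<or> d' = d" using e(3)[OF e(2)] g(3) c c' d d' unfolding ecd ecd' by auto
    ultimately consider "c' = c" "d' = z" | "c' = y" "d' = d" using ne ecd ecd' by auto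
    then show False
    proof cases
      case 1
      then show ?thesis using notri[of c d z] e(1,2) g(2) ecd ecd' z by simp
    next
      case 2
      then show ?thesis using notri[of y d c] e(1,2) g(1) ecd ecd' y by (simp add: insert_commute)
    qed
  qed
  have "M = M'" if M: "M \<in> ?S" "M' \<in> ?S" for M M'
  proof -
    obtain e e' where ee: "M = {e}" "M' = {e'}" using M by (auto simp: card_1_singleton_iff)
    have "e \<in> H" "e' \<in> H" using M maximal_matching_subset unfolding ee by blast+
    moreover have "f \<inter> e \<noteq> {}" "f \<inter> e' \<noteq> {}" if "f \<in> H" for f
      using M that unfolding ee by (auto simp: maximal_matching_iff[OF H(1)])
    ultimately show ?thesis using uniq[of e e'] ee by simp
  qed
  then have S: "card ?S \<le> 1" using finX by (intro card_le_Suc0_iff_eq[THEN iffD2, unfolded One_nat_def[symmetric]]) auto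
  have "g1 \<noteq> {}" using H(1) g(1) by (auto simp: edge_set_def)
  then have gne: "g1 \<noteq> g2" using g(3) by auto
  \<comment> \<open>A maximal extension of \<open>{g1, g2}\<close> is the required matching with
    more than one edge.\<close>
  have "is_matching H {g1, g2}" using g by (auto simp: is_matching_def)
  then obtain M0 where M0: "maximal_matching H M0" "{g1, g2} \<subseteq> M0"
    using is_matching_extend_maximal[OF H(1)] by blast
  have "card M0 \<noteq> 1"
  proof
    assume "card M0 = 1"
    then obtain e where "M0 = {e}" by (auto simp: card_1_singleton_iff)
    then show False using M0 gne by auto
  qed
  then have "M0 \<in> ?X - ?S" using M0 by auto
  then have T: "card (?X - ?S) \<ge> 1" using finX card_gt_0_iff[of "?X - ?S"] by (metis (no_types, lifting) Suc_leI One_nat_def empty_iff finite_Diff)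
  have "mm_sum (\<lambda>c. wt (Suc c)) H = (\<Sum>M\<in>?X - ?S. wt (Suc (card M))) + (\<Sum>M\<in>?S. wt (Suc (card M)))"
    unfolding mm_sum_def using finX by (intro sum.subset_diff) auto
  also have "(\<Sum>M\<in>?X - ?S. wt (Suc (card M))) = (\<Sum>M\<in>?X - ?S. 2)"
    by (intro sum.cong) (auto simp: wt_def)
  also have "(\<Sum>M\<in>?S. wt (Suc (card M))) = (\<Sum>M\<in>?S. - 1)"
    by (intro sum.cong) (auto simp: wt_def)
  finally have "mm_sum (\<lambda>c. wt (Suc c)) H = 2 * real (card (?X - ?S)) - real (card ?S)" by simp
  then show ?thesis using S T by linarith
qed

text \<open>Only matchings of size 2 count negatively. Missing \<open>u\<close>, such a matching
  must cover all neighbours of \<open>u\<close>, of which there are at least four, so it is a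
  perfect matching of a set of exactly four vertices. A 4-set has only three perfect
  matchings.\<close>

lemma mm_sum_missing_wt_ge:
  assumes E: "edge_set E" and N: "card (nbrs E u) \<ge> 4"
  shows "mm_sum_missing wt E u \<ge> - 3"
proof -
  let ?N = "nbrs E u"
  let ?X = "{M. maximal_matching E M \<and> u \<notin> \<Union>M}"
  let ?S = "{M\<in>?X. card M = 2}"
  have finX: "finite ?X" by (rule finite_subset[OF _ finite_maximal_matchings[OF E]]) auto
  have finN: "finite ?N" by (rule finite_nbrs[OF E])
  have S: "\<exists>e f. M = {e, f} \<and> e \<inter> f = {} \<and> e \<union> f = ?N \<and> e \<in> E \<and> f \<in> E \<and> card ?N = 4"
    if M: "M \<in> ?S" for M
  proof -
    have mm: "maximal_matching E M" and uM: "u \<notin> \<Union>M" and c: "card M = 2" using M by auto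
    obtain e f where ef: "M = {e, f}" "e \<noteq> f" using c by (auto simp: card_2_iff)
    have inE: "e \<in> E" "f \<in> E" using maximal_matching_subset[OF mm] ef by auto
    have disj: "e \<inter> f = {}" using maximal_matching_disjoint[OF mm, of e f] ef by blast
    have sub: "?N \<subseteq> e \<union> f"
    proof
      fix v assume "v \<in> ?N"
      then have "{u, v} \<in> E" by (simp add: nbrs_def)
      then obtain g where "g \<in> M" "{u, v} \<inter> g \<noteq> {}" using mm unfolding maximal_matching_iff[OF E] by blast
      then show "v \<in> e \<union> f" using uM ef by auto
    qed
    have fin: "finite (e \<union> f)" and "card (e \<union> f) \<le> 4"
      using E inE card_Un_le[of e f] unfolding edge_set_def by (auto intro: card_ge_0_finite)
    then have "e \<union> f = ?N" using card_seteq[OF fin sub] N \<open>card (e \<union> f) \<le> 4\<close> by simp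
    moreover have "card ?N = 4" using card_mono[OF fin sub] N \<open>card (e \<union> f) \<le> 4\<close> by linarith
    ultimately show ?thesis using ef disj inE by blast
  qed
  have "card ?S \<le> 3"
  proof (cases "?S = {}")
    case False
    then have N4: "card ?N = 4" using S by blast
    then obtain a where a: "a \<in> ?N" by fastforce
    \<comment> \<open>The matching is determined by the partner \<open>b\<close> of a fixed
      neighbour \<open>a\<close>, which leaves three choices.\<close>
    have "?S \<subseteq> (\<lambda>b. {{a, b}, ?N - {a, b}}) ` (?N - {a})"
    proof
      fix M assume M: "M \<in> ?S"
      obtain e f where ef: "M = {e, f}" "e \<inter> f = {}" "e \<union> f = ?N" "e \<in> E" "f \<in> E"
        using S[OF M] by blast
      have "\<exists>e f. M = {e, f} \<and> e \<inter> f = {} \<and> e \<union> f = ?N \<and> e \<in> E \<and> a \<in> e"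
      proof (cases "a \<in> e")
        case False
        then have "a \<in> f" using a ef by blast
        moreover have "M = {f, e}" "f \<inter> e = {}" "f \<union> e = ?N" using ef by auto
        ultimately show ?thesis using ef(5) by blast
      qed (use ef in blast)
      then obtain e f where e: "M = {e, f}" "e \<inter> f = {}" "e \<union> f = ?N" "e \<in> E" "a \<in> e" by blast
      obtain b where b: "e = {a, b}" "b \<noteq> a" using edge_set_obtain[OF E e(4,5)] by metis
      have "f = ?N - {a, b}" "b \<in> ?N - {a}" using e b by auto
      then show "M \<in> (\<lambda>b. {{a, b}, ?N - {a, b}}) ` (?N - {a})" using e(1) b(1) by blast
    qed
    then have "card ?S \<le> card (?N - {a})" using finN by (intro surj_card_le) auto
    then show ?thesis using N4 a finN by simp
  next
    case True
    then show ?thesis by (simp only: card.empty)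
  qed
  moreover have "(\<Sum>M\<in>?X - ?S. wt (card M)) \<ge> 0" by (intro sum_nonneg) (auto simp: wt_def)
  moreover have "(\<Sum>M\<in>?S. wt (card M)) = (\<Sum>M\<in>?S. - 1)"
    by (intro sum.cong) (auto simp: wt_def)
  moreover have "mm_sum_missing wt E u = (\<Sum>M\<in>?X - ?S. wt (card M)) + (\<Sum>M\<in>?S. wt (card M))"
    unfolding mm_sum_missing_def using finX by (intro sum.subset_diff) auto
  ultimately show ?thesis by simp
qed

text \<open>At least four partners of \<open>u\<close> contribute at least 1 each, and the matchings
  that miss \<open>u\<close> lose at most 3.\<close>

lemma mm_sum_wt_nonneg:
  assumes E: "edge_set E" and N: "card (nbrs E u) \<ge> 4"
    and ne: "\<And>v. v \<in> nbrs E u \<Longrightarrow> avoid (avoid E u) v \<noteq> {}"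
    and nostar: "\<And>v z. v \<in> nbrs E u \<Longrightarrow> \<exists>e\<in>avoid (avoid E u) v. z \<notin> e"
    and notri: "\<And>a b c. {a, b} \<in> avoid E u \<Longrightarrow> {b, c} \<in> avoid E u \<Longrightarrow> {a, c} \<in> avoid E u \<Longrightarrow> False"
  shows "mm_sum wt E \<ge> 0"
proof -
  have "mm_sum (\<lambda>c. wt (Suc c)) (avoid (avoid E u) v) \<ge> 1" if v: "v \<in> nbrs E u" for v
  proof (rule mm_sum_wt_ge_1)
    show "edge_set (avoid (avoid E u) v)" using E by (simp add: edge_set_avoid)
    fix a b c
    assume "{a, b} \<in> avoid (avoid E u) v" "{b, c} \<in> avoid (avoid E u) v" "{a, c} \<in> avoid (avoid E u) v"
    then show False using notri[of a b c] by (auto simp: avoid_def)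
  qed (use ne nostar v in blast)+
  then have "(\<Sum>v\<in>nbrs E u. 1) \<le> (\<Sum>v\<in>nbrs E u. mm_sum (\<lambda>c. wt (Suc c)) (avoid (avoid E u) v))"
    by (intro sum_mono) auto
  then have "4 \<le> (\<Sum>v\<in>nbrs E u. mm_sum (\<lambda>c. wt (Suc c)) (avoid (avoid E u) v))"
    using N by simp
  then show ?thesis using mm_sum_missing_wt_ge[OF E N] mm_sum_decompose[OF E, of wt u] by linarith
qed

section \<open>From a nonnegative total weight to the average\<close>

lemma avm_eq_mm_sum: "avm E = mm_sum real E / mm_sum (\<lambda>_. 1) E"
  by (simp add: avm_def mm_sum_def)

text \<open>For each \<open>M\<close>, \<open>k * wt (card M)\<close> is at most
  \<open>(3 * k + 4) * card M - (7 * k + 8)\<close>, with equality at size 2, where both sides are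
  \<open>- k\<close>. The sum is strictly smaller because a nonnegative total weight rules out that
  all sizes are 2.\<close>

lemma avm_gt:
  fixes k :: real
  assumes E: "edge_set E" and k: "k > 0"
    and ge2: "\<And>M. maximal_matching E M \<Longrightarrow> card M \<ge> 2"
    and wt: "mm_sum wt E \<ge> 0"
  shows "avm E > (7 * k + 8) / (3 * k + 4)"
proof -
  let ?X = "{M. maximal_matching E M}"
  have finX: "finite ?X" by (rule finite_maximal_matchings[OF E])
  have "is_matching E {}" by (simp add: is_matching_def)
  then have neX: "?X \<noteq> {}" using is_matching_extend_maximal[OF E] by blast
  have "\<exists>M\<in>?X. card M \<noteq> 2"
  proof (rule ccontr)
    assume "\<not> (\<exists>M\<in>?X. card M \<noteq> 2)"
    then have "mm_sum wt E = (\<Sum>M\<in>?X. - 1)" unfolding mm_sum_def by (intro sum.cong) (auto simp: wt_def)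
    also have "\<dots> < 0" using finX neX by (simp add: card_gt_0_iff)
    finally show False using wt by simp
  qed
  then obtain M0 where M0: "M0 \<in> ?X" "card M0 \<noteq> 2" by blast
  have "k * mm_sum wt E = (\<Sum>M\<in>?X. k * wt (card M))" by (simp add: mm_sum_def sum_distrib_left)
  also have "\<dots> < (\<Sum>M\<in>?X. (3 * k + 4) * card M - (7 * k + 8))"
  proof (rule sum_strict_mono_ex1[OF finX])
    \<comment> \<open>At size 3 the right-hand side is \<open>2 * k + 4\<close>, which explains the
      slack 4; larger sizes only increase it.\<close>
    have *: "k * wt (card M) + 4 \<le> (3 * k + 4) * card M - (7 * k + 8)" if "M \<in> ?X" "card M \<noteq> 2" for M
    proof -
      have "real (card M) \<ge> 3" using ge2[of M] that by auto
      then have "(3 * k + 4) * card M \<ge> (3 * k + 4) * 3" using k by (intro mult_left_mono) auto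
      then show ?thesis using that by (simp add: wt_def)
    qed
    show "\<forall>M\<in>?X. k * wt (card M) \<le> (3 * k + 4) * card M - (7 * k + 8)"
    proof
      fix M assume "M \<in> ?X"
      then show "k * wt (card M) \<le> (3 * k + 4) * card M - (7 * k + 8)"
        using *[of M] by (cases "card M = 2") (auto simp: wt_def)
    qed
    show "\<exists>M\<in>?X. k * wt (card M) < (3 * k + 4) * card M - (7 * k + 8)"
      using *[OF M0] M0(1) by (intro bexI[of _ M0]) auto
  qed
  also have "\<dots> = (3 * k + 4) * (\<Sum>M\<in>?X. real (card M)) - (7 * k + 8) * card ?X"
    by (simp add: sum_subtractf sum_distrib_left)
  finally have "(7 * k + 8) * card ?X < (3 * k + 4) * (\<Sum>M\<in>?X. real (card M))"
    using k wt by (smt (verit) mult_nonneg_nonneg)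
  moreover have "card ?X > 0" using finX neX by (simp add: card_gt_0_iff)
  ultimately show ?thesis unfolding avm_def using k by (simp add: field_simps)
qed

section \<open>Cycles through \<open>u\<close>, opened at \<open>u\<close>\<close>

definition ear :: "'a set set \<Rightarrow> 'a \<Rightarrow> 'a list \<Rightarrow> bool" where
  "ear E u vs \<longleftrightarrow> length vs \<ge> 2 \<and> distinct (u # vs) \<and>
     successively (\<lambda>a b. {a, b} \<in> E) vs \<and> {u, hd vs} \<in> E \<and> {u, last vs} \<in> E"

text \<open>Rotating the cyclic list puts \<open>u\<close> in front. What remains is a path whose
  two ends are adjacent to \<open>u\<close>, and the indices modulo the length are gone.\<close>

lemma cycle_ear:
  assumes c: "is_cycle E c" and u: "u \<in> set c"
  obtains vs where "ear E u vs" "set c = insert u (set vs)"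
proof -
  let ?k = "length c"
  obtain i where i: "i < ?k" "c ! i = u" using u by (auto simp: in_set_conv_nth)
  define d where "d = rotate i c"
  have "c \<noteq> []" using u by auto
  have k: "?k \<ge> 3" and len: "length d = ?k" and dist: "distinct d" and set: "set d = set c"
    using c by (auto simp: is_cycle_def d_def)
  \<comment> \<open>Index \<open>j\<close> of the rotated list is index \<open>j + i\<close> modulo
    the length of the original, so cyclic successors are preserved.\<close>
  have edge: "{d ! j, d ! (Suc j mod ?k)} \<in> E" if "j < ?k" for j
  proof -
    have "Suc j mod ?k < ?k" using k by (intro mod_less_divisor) auto
    then have "d ! (Suc j mod ?k) = c ! ((Suc j mod ?k + i) mod ?k)"
      using nth_rotate[of "Suc j mod ?k" c i] by (simp add: d_def add.commute)
    also have "(Suc j mod ?k + i) mod ?k = ((j + i) mod ?k + 1) mod ?k"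
      by (simp add: mod_simps)
    finally have "d ! (Suc j mod ?k) = c ! (((j + i) mod ?k + 1) mod ?k)" .
    moreover have "d ! j = c ! ((j + i) mod ?k)"
      using nth_rotate[OF that, of i] by (simp add: d_def add.commute)
    moreover have "(j + i) mod ?k < ?k" using k by (intro mod_less_divisor) auto
    ultimately show ?thesis using c by (auto simp: is_cycle_def)
  qed
  have d0: "d ! 0 = u" using nth_rotate[of 0 c i] i \<open>c \<noteq> []\<close> by (simp add: d_def)
  obtain vs where vs: "d = u # vs" using d0 len k by (cases d) auto
  have lvs: "length vs = ?k - 1" using vs len by auto
  have "successively (\<lambda>a b. {a, b} \<in> E) vs"
    unfolding successively_conv_nth
  proof (intro allI impI)
    fix j assume j: "Suc j < length vs"
    then show "{vs ! j, vs ! Suc j} \<in> E" using edge[of "Suc j"] lvs vs by simp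
  qed
  moreover have "{u, hd vs} \<in> E" using edge[of 0] k lvs vs \<open>c \<noteq> []\<close> by (cases vs) auto
  moreover have "{u, last vs} \<in> E"
  proof -
    have "vs \<noteq> []" using lvs k by auto
    then have "last vs = d ! (?k - 1)" using vs lvs k by (simp add: last_conv_nth nth_Cons')
    moreover have "?k - 1 < ?k" "Suc (?k - 1) = ?k" using k by auto
    ultimately show ?thesis using edge[of "?k - 1"] d0 by (simp add: insert_commute)
  qed
  ultimately have "ear E u vs" using lvs k dist vs by (auto simp: ear_def)
  moreover have "set c = insert u (set vs)" using set vs by auto
  ultimately show thesis by (rule that)
qed

lemma ear_rev: "ear E u vs \<Longrightarrow> ear E u (rev vs)"
  by (simp add: ear_def hd_rev last_rev insert_commute)

lemma ear_hd_edge: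
  assumes "ear E u vs"
  obtains b where "b \<in> set vs" "{hd vs, b} \<in> E" "hd vs \<in> set vs" "u \<notin> {hd vs, b}"
proof -
  obtain a b r where "vs = a # b # r"
    using assms by (cases vs; cases "tl vs") (auto simp: ear_def)
  then show thesis using assms that[of b] by (auto simp: ear_def)
qed

lemma ear_last_edge:
  assumes "ear E u vs"
  obtains b where "b \<in> set vs" "{last vs, b} \<in> E" "last vs \<in> set vs" "u \<notin> {last vs, b}"
  using ear_hd_edge[OF ear_rev[OF assms]] assms
  by (metis ear_def hd_rev list.set_sel(1) set_rev)

lemma ear_hd_neq_last: "ear E u vs \<Longrightarrow> hd vs \<noteq> last vs"
  by (cases vs; cases "tl vs") (auto simp: ear_def)

text \<open>A single dominating edge would meet the first edge of each ear, hence join the two ears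
  and avoid \<open>u\<close>. To dominate \<open>{u, hd vs}\<close> and \<open>{u, last vs}\<close>
  it would need both ends of the ear \<open>vs\<close>, but it has only one vertex there.\<close>

lemma two_ears_matching_ge_2:
  assumes E: "edge_set E" and vs: "ear E u vs" and ws: "ear E u ws"
    and disj: "set vs \<inter> set ws = {}" and mm: "maximal_matching E M"
  shows "card M \<ge> 2"
proof (rule ccontr)
  assume "\<not> card M \<ge> 2"
  then have c: "card M \<le> Suc 0" by simp
  have "finite M" using maximal_matching_subset[OF mm] E by (auto simp: edge_set_def intro: finite_subset)
  then have one: "f = g" if "f \<in> M" "g \<in> M" for f g using c that by (meson card_le_Suc0_iff_eq)
  have hit: "\<exists>f\<in>M. e \<inter> f \<noteq> {}" if "e \<in> E" for e using mm that unfolding maximal_matching_iff[OF E] by blast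
  obtain a where a: "a \<in> set vs" "{hd vs, a} \<in> E" "hd vs \<in> set vs" using ear_hd_edge[OF vs] by metis
  obtain b where b: "b \<in> set ws" "{hd ws, b} \<in> E" "hd ws \<in> set ws" using ear_hd_edge[OF ws] by metis
  have l: "last vs \<in> set vs" using ear_last_edge[OF vs] by metis
  obtain f where f: "f \<in> M" "{hd vs, a} \<inter> f \<noteq> {}" using hit[OF a(2)] by blast
  have all: "e \<inter> f \<noteq> {}" if "e \<in> E" for e using hit[OF that] one[OF f(1)] by blast
  obtain p where p: "p \<in> f" "p \<in> set vs" using f a by auto
  obtain q where q: "q \<in> f" "q \<in> set ws" using all[OF b(2)] b by auto
  have "p \<noteq> q" using p q disj by auto
  moreover have "f \<in> E" using f mm maximal_matching_subset by blast
  ultimately have fpq: "f = {p, q}" using edge_set_obtain[OF E _ p(1)] q(1) by (metis insertE singletonD)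
  have u: "u \<notin> f" using fpq p q vs ws by (auto simp: ear_def)
  have "hd vs \<in> f" "last vs \<in> f"
    using all[of "{u, hd vs}"] all[of "{u, last vs}"] u vs by (auto simp: ear_def)
  then have "hd vs = p" "last vs = p" using fpq a(3) l q(2) disj by auto
  then show False using ear_hd_neq_last[OF vs] by simp
qed

section \<open>Connectivity and edge counting\<close>

abbreviation reach :: "'a set set \<Rightarrow> ('a \<times> 'a) set" where
  "reach E \<equiv> {(x, y). {x, y} \<in> E}\<^sup>*"

lemma reach_sym: "(a, b) \<in> reach E \<Longrightarrow> (b, a) \<in> reach E"
proof -
  have "sym {(x, y). {x, y} \<in> E}" by (auto simp: sym_def insert_commute)
  then show "(a, b) \<in> reach E \<Longrightarrow> (b, a) \<in> reach E" by (metis sym_rtrancl symD)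
qed

lemma reach_crossing:
  assumes "(r, v) \<in> reach E" "r \<in> S" "v \<notin> S"
  shows "\<exists>a b. a \<in> S \<and> b \<notin> S \<and> {a, b} \<in> E"
  using assms by (induction rule: rtrancl_induct) auto

text \<open>The set \<open>S\<close> grows by one vertex at a time along an edge that leaves it.
  That edge then lies inside the enlarged set, so each added vertex uses up an edge of its
  own.\<close>

lemma connected_card_edges:
  assumes V: "finite V" "finite E" "\<And>e. e \<in> E \<Longrightarrow> e \<subseteq> V" and conn: "connected_graph V E"
    and S: "S \<subseteq> V" "S \<noteq> {}"
  shows "card (V - S) \<le> card {e\<in>E. \<not> e \<subseteq> S}"
  using S
proof (induction "card (V - S)" arbitrary: S)
  case (Suc k)
  then have "V - S \<noteq> {}" by (metis card.empty nat.distinct(1))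
  then obtain v r where "v \<in> V - S" "r \<in> S" using Suc.prems by blast
  then have "(r, v) \<in> reach E" using conn Suc.prems by (auto simp: connected_graph_def)
  then obtain a b where ab: "a \<in> S" "b \<notin> S" "{a, b} \<in> E"
    using reach_crossing[of r v E S] \<open>v \<in> V - S\<close> \<open>r \<in> S\<close> by blast
  have b: "b \<in> V" using V(3)[OF ab(3)] by simp
  have "V - insert b S = (V - S) - {b}" by auto
  then have c: "card (V - insert b S) = k" using b ab Suc.hyps(2) V(1) by simp
  have "card (V - insert b S) \<le> card {e\<in>E. \<not> e \<subseteq> insert b S}"
    using Suc.hyps(1)[of "insert b S"] c b Suc.prems by simp
  moreover have "{e\<in>E. \<not> e \<subseteq> insert b S} \<subset> {e\<in>E. \<not> e \<subseteq> S}"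
  proof
    show "{e\<in>E. \<not> e \<subseteq> insert b S} \<subseteq> {e\<in>E. \<not> e \<subseteq> S}" by auto
    have "{a, b} \<in> {e\<in>E. \<not> e \<subseteq> S} - {e\<in>E. \<not> e \<subseteq> insert b S}" using ab by simp
    then show "{e\<in>E. \<not> e \<subseteq> insert b S} \<noteq> {e\<in>E. \<not> e \<subseteq> S}" by blast
  qed
  then have "card {e\<in>E. \<not> e \<subseteq> insert b S} < card {e\<in>E. \<not> e \<subseteq> S}"
    using V(2) by (intro psubset_card_mono) auto
  ultimately show ?case using c Suc.hyps(2) by linarith
qed simp

lemma connected_card_le:
  assumes "finite V" "finite E" "\<And>e. e \<in> E \<Longrightarrow> e \<subseteq> V" "connected_graph V E"
  shows "card V \<le> card E + 1"
proof (cases "V = {}")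
  case False
  then obtain r where r: "r \<in> V" by blast
  have "card (V - {r}) \<le> card {e\<in>E. \<not> e \<subseteq> {r}}"
    using connected_card_edges[OF assms, of "{r}"] r by simp
  also have "\<dots> \<le> card E" using assms(2) by (intro card_mono) auto
  finally show ?thesis using r assms(1) by simp
qed simp

lemma connected_remove_edge:
  assumes conn: "connected_graph V E" and ab: "(a, b) \<in> reach (E - {{a, b}})"
  shows "connected_graph V (E - {{a, b}})"
proof -
  have "{(x, y). {x, y} \<in> E} \<subseteq> reach (E - {{a, b}})"
  proof safe
    fix x y assume xy: "{x, y} \<in> E"
    show "(x, y) \<in> reach (E - {{a, b}})"
    proof (cases "{x, y} = {a, b}")
      case True
      then have "x = a \<and> y = b \<or> x = b \<and> y = a" by (simp add: doubleton_eq_iff)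
      then show ?thesis using ab reach_sym by metis
    next
      case False
      then show ?thesis using xy by (intro r_into_rtrancl) simp
    qed
  qed
  then have "reach E \<subseteq> reach (E - {{a, b}})" by (rule rtrancl_subset_rtrancl)
  then show ?thesis using conn unfolding connected_graph_def by blast
qed

lemma walk_reach:
  "successively (\<lambda>a b. {a, b} \<in> E) vs \<Longrightarrow> vs \<noteq> [] \<Longrightarrow> (hd vs, last vs) \<in> reach E"
proof (induction vs rule: induct_list012)
  case (3 x y zs)
  then have "(x, y) \<in> {(x, y). {x, y} \<in> E}" "(y, last (y # zs)) \<in> reach E" by auto
  then have "(x, last (y # zs)) \<in> reach E" by (rule converse_rtrancl_into_rtrancl)
  then show ?case by simp
qed auto

text \<open>The detour around the ear, entered from \<open>u\<close> at its far end, replaces the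
  edge \<open>{u, hd vs}\<close>. The edge set \<open>E'\<close> may have lost other edges at
  \<open>u\<close>, so the argument applies to both ears in succession.\<close>

lemma ear_reach:
  assumes ear: "ear E u vs" and E': "{u, last vs} \<in> E'" "\<And>e. e \<in> E \<Longrightarrow> u \<notin> e \<Longrightarrow> e \<in> E'"
  shows "(u, hd vs) \<in> reach E'"
proof -
  have "successively (\<lambda>a b. {a, b} \<in> E') vs"
  proof (rule successively_mono[of "\<lambda>a b. {a, b} \<in> E"])
    show "successively (\<lambda>a b. {a, b} \<in> E) vs" using ear by (simp add: ear_def)
    fix a b assume "a \<in> set vs" "b \<in> set vs" "{a, b} \<in> E"
    then show "{a, b} \<in> E'" using E'(2)[of "{a, b}"] ear by (auto simp: ear_def)
  qed
  moreover have "vs \<noteq> []" using ear by (auto simp: ear_def)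
  ultimately have "(last vs, hd vs) \<in> reach E'" using walk_reach reach_sym by metis
  moreover have "(u, last vs) \<in> {(x, y). {x, y} \<in> E'}" using E'(1) by simp
  ultimately show ?thesis by (rule converse_rtrancl_into_rtrancl[rotated])
qed

text \<open>One edge of each ear at \<open>u\<close> and one edge of the triangle can be deleted without
  disconnecting the graph, which would leave fewer than \<open>card V - 1\<close> edges.\<close>
lemma no_triangle_avoiding:
  assumes G: "simple_graph V E" "connected_graph V E" "card E = card V + 1"
    and vs: "ear E u vs" and ws: "ear E u ws" and disj: "set vs \<inter> set ws = {}"
    and abc: "{a, b} \<in> E" "{b, c} \<in> E" "{a, c} \<in> E" and u: "u \<notin> {a, b, c}"
  shows False
proof -
  have sub: "e \<subseteq> V" and two: "card e = 2" if "e \<in> E" for e using G(1) that by (auto simp: simple_graph_def)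
  have finV: "finite V" using G(1) by (simp add: simple_graph_def)
  have finE: "finite E" by (rule finite_subset[of _ "Pow V"]) (use sub finV in auto)
  have es: "edge_set E" using finE two by (simp add: edge_set_def)
  have neq: "a \<noteq> b" "b \<noteq> c" "a \<noteq> c" using edge_set_nbr_neq[OF es] abc by auto
  have h: "hd vs \<in> set vs" "last vs \<in> set vs" "hd ws \<in> set ws" "last ws \<in> set ws"
    using ear_hd_edge[OF vs] ear_last_edge[OF vs] ear_hd_edge[OF ws] ear_last_edge[OF ws] by metis+
  have d: "hd vs \<noteq> last vs" "hd ws \<noteq> last ws" "hd vs \<noteq> hd ws" "hd vs \<noteq> last ws"
    using ear_hd_neq_last[OF vs] ear_hd_neq_last[OF ws] h disj by auto
  have uE: "{u, hd vs} \<in> E" "{u, last vs} \<in> E" "{u, hd ws} \<in> E" "{u, last ws} \<in> E"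
    using vs ws by (auto simp: ear_def)
  define E1 where "E1 = E - {{u, hd vs}}"
  define E2 where "E2 = E1 - {{u, hd ws}}"
  define E3 where "E3 = E2 - {{a, b}}"
  have "(u, hd vs) \<in> reach E1"
    by (rule ear_reach[OF vs]) (use uE d in \<open>auto simp: E1_def doubleton_eq_iff\<close>)
  then have "connected_graph V E1" using connected_remove_edge[OF G(2)] by (simp add: E1_def)
  moreover have "(u, hd ws) \<in> reach E2"
    by (rule ear_reach[OF ws]) (use uE d in \<open>auto simp: E1_def E2_def doubleton_eq_iff\<close>)
  ultimately have "connected_graph V E2" using connected_remove_edge by (simp add: E2_def)
  moreover have "(a, b) \<in> reach E3"
  proof -
    have "{a, c} \<in> E3" "{c, b} \<in> E3"
      using abc u neq by (auto simp: E1_def E2_def E3_def doubleton_eq_iff insert_commute)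
    then have "(a, c) \<in> reach E3" "(c, b) \<in> reach E3" by (auto intro: r_into_rtrancl)
    then show ?thesis by (rule rtrancl_trans)
  qed
  ultimately have "connected_graph V E3" using connected_remove_edge by (simp add: E3_def)
  then have le: "card V \<le> card E3 + 1"
    by (intro connected_card_le) (use finV finE sub in \<open>auto simp: E1_def E2_def E3_def\<close>)
  have "{u, hd ws} \<in> E1" "{a, b} \<in> E2"
    using uE abc u d by (auto simp: E1_def E2_def doubleton_eq_iff)
  then have "card E1 = card E - 1" "card E2 = card E1 - 1" "card E3 = card E2 - 1"
    using uE(1) by (simp_all add: E1_def E2_def E3_def)
  then have "card E3 = card V - 2" using G(3) by simp
  \<comment> \<open>Subtraction is truncated, so \<open>card V - 2\<close> contradicts the lower
    bound on \<open>card E3\<close> only once two vertices are known.\<close>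
  moreover have "u \<in> V" "hd vs \<in> V" "u \<noteq> hd vs" using sub[OF uE(1)] edge_set_nbr_neq[OF es uE(1)] by auto
  then have "card {u, hd vs} \<le> card V" using finV by (intro card_mono) auto
  then have "card V \<ge> 2" using \<open>u \<noteq> hd vs\<close> by simp
  ultimately show False using le by linarith
qed

lemma connected_incident_edge:
  assumes conn: "connected_graph V E" and v: "v \<in> V" "w \<in> V" "v \<noteq> w"
  shows "\<exists>x. {v, x} \<in> E"
proof -
  have "(v, w) \<in> reach E" using conn v by (simp add: connected_graph_def)
  then show ?thesis using v(3) by (cases rule: converse_rtranclE) auto
qed

section \<open>Structure of the graph when some \<open>G - u - v\<close> is a star\<close>

lemma doubleton_other: "x \<in> {a, b} \<Longrightarrow> a \<noteq> b \<Longrightarrow> \<exists>y. {a, b} = {x, y} \<and> y \<noteq> x"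
  by (cases "x = a") auto

text \<open>Without \<open>u\<close> the graph consists of stars at \<open>x\<close> and
  \<open>z\<close>. The ends of the two ears are four neighbours of \<open>u\<close> on these stars,
  and \<open>card E = card V + 1\<close> permits nothing further: the stars are disjoint, and
  \<open>u\<close> has no other neighbour on them. One ear is then \<open>x\<close> and a leaf
  \<open>y\<close>; the other gives a triangle or a 4-cycle according to whether \<open>z\<close> is
  adjacent to \<open>u\<close>.\<close>

lemma two_star_structure_oriented:
  assumes G: "finite V" "edge_set E" "\<And>e. e \<in> E \<Longrightarrow> e \<subseteq> V" "\<And>v. v \<in> V \<Longrightarrow> \<exists>x. {v, x} \<in> E"
    and card: "card E = card V + 1"
    and vs: "ear E u vs" and ws: "ear E u ws" and disj: "set vs \<inter> set ws = {}"
    and x: "x \<in> nbrs E u" "x \<in> set vs" and z: "z \<in> set ws"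
    and cover: "\<And>e. e \<in> E \<Longrightarrow> u \<in> e \<or> x \<in> e \<or> z \<in> e"
  shows "(\<exists>y w A B C. two_triangles u x y z w A B C E \<and> V = {u, x, y, z, w} \<union> A \<union> B \<union> C) \<or>
    (\<exists>y w w' A B C. triangle_square u x y z w w' A B C E)"
proof -
  define F where "F = avoid E u"
  define N where "N = nbrs E u"
  define P where "P = nbrs F x"
  define Q where "Q = nbrs F z"
  have finF: "finite F" and esF: "edge_set F" and FE: "F \<subseteq> E"
    using edge_set_avoid[OF G(2)] by (auto simp: F_def edge_set_def avoid_def)
  have fin: "finite N" "finite P" "finite Q"
    using finite_nbrs G(2) esF by (auto simp: N_def P_def Q_def)
  have ux: "u \<noteq> x" "u \<noteq> z" "x \<noteq> z" using vs ws x z disj by (auto simp: ear_def)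
  have uN: "u \<notin> N" using nbrs_irrefl[OF G(2)] by (simp add: N_def)
  have uPQ: "u \<notin> P" "u \<notin> Q" by (auto simp: P_def Q_def nbrs_def F_def avoid_def)
  have xP: "x \<notin> P" and zQ: "z \<notin> Q"
    using nbrs_irrefl[OF esF] by (simp_all add: P_def Q_def)
  have F: "F = star x P \<union> star z Q"
  proof (intro subset_antisym subsetI)
    fix e assume e: "e \<in> F"
    then have "x \<in> e \<or> z \<in> e" using cover by (auto simp: F_def avoid_def)
    then show "e \<in> star x P \<union> star z Q"
    proof
      assume "x \<in> e"
      then obtain p where "e = {x, p}" using edge_set_obtain[OF esF e] by metis
      then show ?thesis using e by (simp add: P_def nbrs_def)
    next
      assume "z \<in> e"
      then obtain p where "e = {z, p}" using edge_set_obtain[OF esF e] by metis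
      then show ?thesis using e by (simp add: Q_def nbrs_def)
    qed
  qed (auto simp: mem_star P_def Q_def nbrs_def)
  have EN: "E = star u N \<union> F"
  proof (intro subset_antisym subsetI)
    fix e assume e: "e \<in> E"
    show "e \<in> star u N \<union> F"
    proof (cases "u \<in> e")
      case True
      then obtain p where "e = {u, p}" using edge_set_obtain[OF G(2) e] by metis
      then show ?thesis using e by (simp add: N_def nbrs_def)
    qed (use e in \<open>simp add: F_def avoid_def\<close>)
  qed (use FE in \<open>auto simp: mem_star N_def nbrs_def\<close>)
  have "star u N \<inter> F = {}" by (auto simp: mem_star F_def avoid_def)
  then have cE: "card N + card F = card V + 1"
    using card EN fin(1) finF by (simp add: card_Un_disjoint card_star finite_star)
  let ?XZ = "insert x P \<union> insert z Q"
  have Vsub: "V - {u} \<subseteq> ?XZ \<union> N"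
  proof
    fix v assume v: "v \<in> V - {u}"
    then obtain p where p: "{v, p} \<in> E" using G(4) by blast
    then consider "{v, p} \<in> star u N" | "{v, p} \<in> star x P" | "{v, p} \<in> star z Q"
      using EN F by blast
    then show "v \<in> ?XZ \<union> N"
      by cases (use v in \<open>auto simp: mem_star doubleton_eq_iff\<close>)
  qed
  have inV: "x \<in> V" "N \<subseteq> V" "P \<subseteq> V" "Q \<subseteq> V" "u \<in> V"
    using x(1) G(3) FE by (auto simp: N_def P_def Q_def nbrs_def)
  have inF: "{a, b} \<in> F" if "{a, b} \<in> E" "u \<notin> {a, b}" for a b using that by (simp add: F_def avoid_def)
  obtain b1 where b1: "b1 \<in> set vs" "{hd vs, b1} \<in> F" "hd vs \<in> set vs"
    using ear_hd_edge[OF vs] inF by metis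
  obtain b2 where b2: "b2 \<in> set vs" "{last vs, b2} \<in> F" "last vs \<in> set vs"
    using ear_last_edge[OF vs] inF by metis
  obtain b3 where b3: "b3 \<in> set ws" "{hd ws, b3} \<in> F" "hd ws \<in> set ws"
    using ear_hd_edge[OF ws] inF by metis
  obtain b4 where b4: "b4 \<in> set ws" "{last ws, b4} \<in> F" "last ws \<in> set ws"
    using ear_last_edge[OF ws] inF by metis
  \<comment> \<open>An edge within the ear \<open>vs\<close> cannot contain \<open>z\<close>, which
    lies on the other ear, so it belongs to the star at \<open>x\<close>.\<close>
  have inX: "a \<in> insert x P" if "a \<in> set vs" "b \<in> set vs" "{a, b} \<in> F" for a b
  proof -
    have "z \<notin> {a, b}" using that z disj by auto
    then have "x = a \<or> x = b" using cover[of "{a, b}"] that(3) by (auto simp: F_def avoid_def)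
    then show ?thesis using that(3) by (auto simp: P_def nbrs_def insert_commute)
  qed
  have inZ: "a \<in> insert z Q" if "a \<in> set ws" "b \<in> set ws" "{a, b} \<in> F" for a b
  proof -
    have "x \<notin> {a, b}" using that x(2) disj by auto
    then have "z = a \<or> z = b" using cover[of "{a, b}"] that(3) by (auto simp: F_def avoid_def)
    then show ?thesis using that(3) by (auto simp: Q_def nbrs_def insert_commute)
  qed
  have ends: "hd vs \<in> insert x P" "last vs \<in> insert x P" "hd ws \<in> insert z Q" "last ws \<in> insert z Q"
    using inX[OF b1(3,1,2)] inX[OF b2(3,1,2)] inZ[OF b3(3,1,2)] inZ[OF b4(3,1,2)] by auto
  have zV: "z \<in> V" using b3 b4 inZ[OF b3(3,1,2)] FE G(3) cover[of "{hd ws, b3}"] x(2) disj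
    by (auto simp: F_def avoid_def)
  have endsN: "hd vs \<in> N" "last vs \<in> N" "hd ws \<in> N" "last ws \<in> N"
    using vs ws by (auto simp: ear_def N_def nbrs_def)
  have d: "hd vs \<noteq> last vs" "hd ws \<noteq> last ws"
    using ear_hd_neq_last[OF vs] ear_hd_neq_last[OF ws] by auto
  let ?S = "{hd vs, last vs, hd ws, last ws}"
  have dS: "hd vs \<noteq> hd ws" "hd vs \<noteq> last ws" "last vs \<noteq> hd ws" "last vs \<noteq> last ws"
    using b1(3) b2(3) b3(3) b4(3) disj by auto
  have cS: "card ?S = 4" using d dS by simp
  have SN: "?S \<subseteq> N \<inter> ?XZ" using ends endsN by blast
  have Veq: "V - {u} = N \<union> ?XZ"
    using Vsub inV zV uN uPQ ux by blast
  have "card (V - {u}) + card (N \<inter> ?XZ) = card N + card ?XZ"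
    unfolding Veq using card_Un_Int[of N ?XZ] fin by simp
  moreover have "card (V - {u}) = card V - 1" "card V \<ge> 1"
    using inV(5) G(1) by (auto simp: Suc_le_eq card_gt_0_iff)
  moreover have S4: "card (N \<inter> ?XZ) \<ge> 4" using card_mono[OF _ SN] fin(1) cS by simp
  ultimately have key: "card ?XZ = card F + card (N \<inter> ?XZ) - 2" using cE by linarith
  \<comment> \<open>If \<open>x\<close> and \<open>z\<close> were adjacent, the edge
    \<open>{x, z}\<close> would be shared by both stars and \<open>?XZ\<close> would be just
    \<open>P \<union> Q\<close>, with at most \<open>card F + 1\<close> elements, one too
    few.\<close>
  have xz: "z \<notin> P" "x \<notin> Q"
  proof -
    have "z \<in> P \<longleftrightarrow> x \<in> Q" by (simp add: P_def Q_def nbrs_def insert_commute)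
    moreover have False if zP: "z \<in> P" and xQ: "x \<in> Q"
    proof -
      have "star z Q = insert {x, z} (star z (Q - {x}))"
        using xQ by (auto simp: star_def insert_commute)
      then have "F = star x P \<union> star z (Q - {x})"
        using zP unfolding F by (simp add: insert_absorb)
      moreover have "star x P \<inter> star z (Q - {x}) = {}"
        using ux by (auto simp: mem_star doubleton_eq_iff)
      ultimately have "card F = card P + card (Q - {x})"
        using fin by (simp add: card_Un_disjoint card_star finite_star)
      moreover have "?XZ = P \<union> Q" using zP xQ by auto
      moreover have "card (P \<union> Q) \<le> card P + card Q" by (rule card_Un_le)
      moreover have "card (Q - {x}) = card Q - 1" "card Q \<ge> 1"
        using xQ fin by (auto simp: Suc_le_eq card_gt_0_iff)
      ultimately show False using key S4 by simp
    qed
    ultimately show "z \<notin> P" "x \<notin> Q" by blast+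
  qed
  have "star x P \<inter> star z Q = {}" using ux xz by (auto simp: mem_star doubleton_eq_iff)
  then have cF: "card F = card P + card Q"
    unfolding F using fin by (simp add: card_Un_disjoint card_star finite_star)
  have "?XZ = insert x (insert z (P \<union> Q))" by auto
  then have cXZ: "card ?XZ = card (P \<union> Q) + 2" using xP zQ xz ux fin by simp
  have "card (P \<union> Q) + card (P \<inter> Q) = card P + card Q" using card_Un_Int[of P Q] fin by simp
  \<comment> \<open>Since \<open>?XZ\<close> has at most
    \<open>card P + card Q + 2 = card F + 2\<close> elements, both estimates are equalities.\<close>
  then have "card (P \<inter> Q) = 0" and cNS: "card (N \<inter> ?XZ) = 4" using key cXZ cF S4 by linarith+
  then have PQ: "P \<inter> Q = {}" using fin by simp
  have NS: "N \<inter> ?XZ = ?S" using card_seteq[OF _ SN] cNS cS fin by simp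
  have XZ: "insert x P \<inter> insert z Q = {}" using PQ xP zQ xz ux by auto
  have NX: "N \<inter> insert x P = {hd vs, last vs}" using NS XZ ends by blast
  have NZ: "N \<inter> insert z Q = {hd ws, last ws}" using NS XZ ends by blast
  have "x \<in> {hd vs, last vs}" using NX x(1) by (auto simp: N_def)
  then obtain y where y: "{hd vs, last vs} = {x, y}" "y \<noteq> x"
    using doubleton_other d(1) by metis
  then have yP: "y \<in> P" and NXy: "N \<inter> insert x P = {x, y}" using NX by auto
  have EE: "E = star u N \<union> star x P \<union> star z Q" using EN F by auto
  define A where "A = N - ?S"
  define B where "B = P - {y}"
  have PB: "P = insert y B" using yP by (auto simp: B_def)
  have AN: "N = ?S \<union> A" using NS by (auto simp: A_def)
  have Sxy: "?S = {x, y, hd ws, last ws}" using y by auto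
  show ?thesis
  \<comment> \<open>If \<open>z\<close> is an end of its ear, that ear closes to a triangle.
    Otherwise both ends are leaves of the star at \<open>z\<close> and \<open>z\<close> is not
    adjacent to \<open>u\<close>, which gives the 4-cycle.\<close>
  proof (cases "z \<in> {hd ws, last ws}")
    case True
    then obtain w where w: "{hd ws, last ws} = {z, w}" "w \<noteq> z"
      using doubleton_other d(2) by metis
    then have wQ: "w \<in> Q" and NZw: "N \<inter> insert z Q = {z, w}" using NZ by auto
    define C where "C = Q - {w}"
    have QC: "Q = insert w C" using wQ by (auto simp: C_def)
    have Sw: "?S = {x, y, z, w}" using Sxy w by auto
    have AA: "A = N - {x, y, z, w}" unfolding A_def Sw ..
    have "two_triangles u x y z w A B C E"
      unfolding two_triangles_def
    proof (intro conjI)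
      show "distinct [u, x, y, z, w]" using ux y(2) w(2) yP wQ uPQ xz PQ by auto
      show "{u, x, y, z, w} \<inter> (A \<union> B \<union> C) = {}"
        using uN uPQ xP zQ xz PQ yP wQ unfolding AA B_def C_def by blast
      show "A \<inter> B = {}" using NXy unfolding AA B_def by blast
      show "A \<inter> C = {}" using NZw unfolding AA C_def by blast
      show "B \<inter> C = {}" using PQ unfolding B_def C_def by blast
      show "E = star u ({x, y, z, w} \<union> A) \<union> star x (insert y B) \<union> star z (insert w C)"
        using EE AN PB QC Sw by simp
    qed (use fin in \<open>auto simp: A_def B_def C_def\<close>)
    moreover have "V = {u, x, y, z, w} \<union> A \<union> B \<union> C"
    proof -
      have "V = insert u (N \<union> ?XZ)" using Veq inV(5) by blast
      then show ?thesis using AN Sw PB QC by auto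
    qed
    ultimately show ?thesis by blast
  next
    case False
    let ?w = "hd ws" and ?w' = "last ws"
    define C where "C = Q - {?w, ?w'}"
    have wQ: "?w \<in> Q" "?w' \<in> Q" using ends False by auto
    then have QC: "Q = {?w, ?w'} \<union> C" by (auto simp: C_def)
    have AA: "A = N - {x, y, ?w, ?w'}" unfolding A_def Sxy ..
    have zN: "z \<notin> N" using NZ False by blast
    have "triangle_square u x y z ?w ?w' A B C E"
      unfolding triangle_square_def
    proof (intro conjI)
      show "distinct [u, x, y, z, ?w, ?w']" using ux y(2) d(2) yP wQ uPQ xz zQ PQ by auto
      show "{u, x, y, z, ?w, ?w'} \<inter> (A \<union> B \<union> C) = {}"
        using uN uPQ xP zQ xz PQ yP wQ zN unfolding AA B_def C_def by blast
      show "A \<inter> B = {}" using NXy unfolding AA B_def by blast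
      show "A \<inter> C = {}" using NZ unfolding AA C_def by blast
      show "B \<inter> C = {}" using PQ unfolding B_def C_def by blast
      show "E = star u ({x, y, ?w, ?w'} \<union> A) \<union> star x (insert y B) \<union> star z ({?w, ?w'} \<union> C)"
        using EE AN PB QC Sxy by simp
    qed (use fin in \<open>auto simp: A_def B_def C_def\<close>)
    then show ?thesis by blast
  qed
qed

text \<open>Each ear has an edge off \<open>u\<close>, which must contain \<open>x\<close> or
  \<open>z\<close>. Since the ears are disjoint, \<open>x\<close> and \<open>z\<close> lie on
  different ears, and interchanging the ears reduces to the oriented version.\<close>

lemma two_star_structure:
  assumes G: "finite V" "edge_set E" "\<And>e. e \<in> E \<Longrightarrow> e \<subseteq> V" "\<And>v. v \<in> V \<Longrightarrow> \<exists>x. {v, x} \<in> E"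
    and card: "card E = card V + 1"
    and vs: "ear E u vs" and ws: "ear E u ws" and disj: "set vs \<inter> set ws = {}"
    and x: "x \<in> nbrs E u"
    and cover: "\<And>e. e \<in> E \<Longrightarrow> u \<in> e \<or> x \<in> e \<or> z \<in> e"
  shows "(\<exists>y w A B C. two_triangles u x y z w A B C E \<and> V = {u, x, y, z, w} \<union> A \<union> B \<union> C) \<or>
    (\<exists>y w w' A B C. triangle_square u x y z w w' A B C E)"
proof -
  obtain a where a: "a \<in> set vs" "{hd vs, a} \<in> E" "hd vs \<in> set vs" "u \<notin> {hd vs, a}"
    using ear_hd_edge[OF vs] by metis
  obtain b where b: "b \<in> set ws" "{hd ws, b} \<in> E" "hd ws \<in> set ws" "u \<notin> {hd ws, b}"
    using ear_hd_edge[OF ws] by metis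
  have "x \<in> set vs \<or> z \<in> set vs" using cover[OF a(2)] a by auto
  moreover have "x \<in> set ws \<or> z \<in> set ws" using cover[OF b(2)] b by auto
  ultimately consider "x \<in> set vs" "z \<in> set ws" | "x \<in> set ws" "z \<in> set vs"
    using disj by blast
  then show ?thesis
  proof cases
    case 1
    then show ?thesis by (intro two_star_structure_oriented[OF G card vs ws disj x _ _ cover])
  next
    case 2
    have "set ws \<inter> set vs = {}" using disj by blast
    then show ?thesis using 2 by (intro two_star_structure_oriented[OF G card ws vs _ x _ _ cover])
  qed
qed

section \<open>Total weights of the two families\<close>

lemma triangle_square_wt_nonneg:
  assumes "triangle_square u x y z w w' A B C E"
  shows "mm_sum wt E \<ge> 0"
proof -
  let ?a = "real (card A)" and ?b = "real (card B)" and ?c = "real (card C)"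
  \<comment> \<open>With sizes \<open>a\<close>, \<open>b\<close>, \<open>c\<close>, the negative
    terms amount to at most \<open>2 * (c + 2)\<close> in absolute value, and the partners
    \<open>w\<close> and \<open>w'\<close> contribute \<open>4 * (b + 1) * (c + 1)\<close>. The
    products are given signs separately because linear arithmetic treats them as atoms.\<close>
  have p: "?a * (?b * ?c) \<ge> 0" "?a * ?b \<ge> 0" "?a * ?c \<ge> 0" "?b * ?c \<ge> 0" by simp_all
  show ?thesis
  proof (cases "card B = 0")
    case True
    then show ?thesis using p
      unfolding mm_sum_triangle_square[OF assms] by (simp add: pair_val_def wt_def algebra_simps)
  next
    case False
    then show ?thesis using p
      unfolding mm_sum_triangle_square[OF assms] by (simp add: pair_val_def wt_def algebra_simps)
  qed
qed

lemma two_triangles_swap: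
  "two_triangles u x y z w A B C E \<Longrightarrow> two_triangles u z w x y A C B E"
  unfolding two_triangles_def by (simp add: ac_simps insert_commute) blast

text \<open>The second assumption leaves out only graphs of negative weight: two bare triangles,
  R_n(3,3) up to exchanging the triangles (weight -4), and a single leaf at \<open>u\<close> (weight
  -2). With sizes \<open>a\<close>, \<open>b\<close>, \<open>c\<close>, the weight is
  \<open>2 * a * (c + 1) - 3\<close> if only \<open>B\<close> is empty, symmetrically if only
  \<open>C\<close> is, and \<open>2 * a - 4\<close> if only \<open>A\<close> is nonempty.\<close>

lemma two_triangles_wt_nonneg:
  assumes T: "two_triangles u x y z w A B C E"
    and "B \<noteq> {} \<and> C \<noteq> {} \<or> A \<noteq> {} \<and> (B \<noteq> {} \<or> C \<noteq> {}) \<or> card A \<ge> 2"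
  shows "mm_sum wt E \<ge> 0"
proof -
  let ?a = "real (card A)" and ?b = "real (card B)" and ?c = "real (card C)"
  have fin: "finite A" "finite B" "finite C" using T by (simp_all add: two_triangles_def)
  have pos: "?a \<ge> 1 \<longleftrightarrow> A \<noteq> {}" "?b \<ge> 1 \<longleftrightarrow> B \<noteq> {}" "?c \<ge> 1 \<longleftrightarrow> C \<noteq> {}"
    using fin by (simp_all add: Suc_le_eq card_gt_0_iff)
  have p: "?a * (?b * ?c) \<ge> 0" "?a * ?b \<ge> 0" "?a * ?c \<ge> 0" "?b * ?c \<ge> 0" by simp_all
  note formula = mm_sum_two_triangles[OF T, of wt]
  consider "B \<noteq> {}" "C \<noteq> {}" | "A \<noteq> {}" "B = {}" "C \<noteq> {}" | "A \<noteq> {}" "B \<noteq> {}" "C = {}"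
    | "B = {}" "C = {}" "card A \<ge> 2"
    using assms(2) by fastforce
  then show ?thesis
  proof cases
    case 1
    then have bc: "?b * ?c \<ge> 1" "?b \<ge> 1" "?c \<ge> 1"
      using pos mult_mono[of 1 ?b 1 ?c] by simp_all
    have aux: "0 \<le> m"
      if "m = 4 * r + b + c - 2 + 2 * s + d" "r \<ge> 1" "b \<ge> 1" "c \<ge> 1" "s \<ge> 0" "d \<ge> - 1"
      for m r b c s d :: real using that by linarith
    have "mm_sum wt E = 4 * (?b * ?c) + ?b + ?c - 2
        + 2 * (?a + ?a * ?b + ?a * ?c + ?a * (?b * ?c)) + (if A = {} then - 1 else 0)"
      unfolding formula using 1 fin by (simp add: pair_val_def wt_def algebra_simps)
    then show ?thesis by (rule aux[OF _ bc]) simp_all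
  next
    case 2
    then have "?a * ?c \<ge> 1" using pos mult_mono[of 1 ?a 1 ?c] by simp
    then show ?thesis using p pos 2 fin
      unfolding formula by (simp add: pair_val_def wt_def algebra_simps)
  next
    case 3
    then have "?a * ?b \<ge> 1" using pos mult_mono[of 1 ?a 1 ?b] by simp
    then show ?thesis using p pos 3 fin
      unfolding formula by (simp add: pair_val_def wt_def algebra_simps)
  next
    case 4
    then have "?a \<ge> 2" "A \<noteq> {}" by auto
    then show ?thesis using 4
      unfolding formula by (simp add: pair_val_def wt_def algebra_simps)
  qed
qed

section \<open>The average of R_n(3,3) and recognition of this graph\<close>

lemma R_E_two_triangles:
  assumes "n \<ge> 6"
  shows "two_triangles 0 3 4 1 2 {} {} {5..<n} (R_E n)"
proof -
  have "{{1, k} | k. 5 \<le> k \<and> k < n} = star 1 {5..<n}" by (auto simp: star_def)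
  moreover have "star 1 (insert 2 {5..<n}) = insert {1, 2} (star 1 {5..<n})" by (simp add: star_def)
  moreover have "star 0 {3, 4, 1, 2} = {{0, 1}, {0, 2}, {0, 3}, {0, 4 :: nat}}" "star 3 {4 :: nat} = {{3, 4}}"
    by (auto simp: star_def)
  ultimately have "R_E n = star 0 {3, 4, 1, 2} \<union> star 3 {4} \<union> star 1 (insert 2 {5..<n})"
    unfolding R_E_def by auto
  then show ?thesis by (simp add: two_triangles_def)
qed

lemma avm_R_E:
  assumes "n \<ge> 6"
  shows "avm (R_E n) = (7 * real (n - 5) + 8) / (3 * real (n - 5) + 4)"
proof -
  \<comment> \<open>At least one leaf is present, so for the partner 2 of the common vertex
    \<open>pair_val\<close> takes its product branch.\<close>
  have "n - 5 \<noteq> 0" using assms by simp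
  then have "mm_sum real (R_E n) = 7 * real (n - 5) + 8"
    "mm_sum (\<lambda>_. 1) (R_E n) = 3 * real (n - 5) + 4"
    unfolding mm_sum_two_triangles[OF R_E_two_triangles[OF assms]]
    by (simp_all add: pair_val_def algebra_simps del: of_nat_diff)
  then show ?thesis by (simp add: avm_eq_mm_sum)
qed

lemma image_star: "(`) f ` star v B = star (f v) (f ` B)"
  by (auto simp: star_def image_image)

lemma two_triangles_iso_R:
  assumes T: "two_triangles u x y z w {} {} C E" and V: "V = {u, x, y, z, w} \<union> C"
    and n: "n = card V" "n \<ge> 6"
  shows "graph_iso V E (R_V n) (R_E n)"
proof -
  have dist: "distinct [u, x, y, z, w]" and C: "finite C" "{u, x, y, z, w} \<inter> C = {}"
    and E: "E = star u {x, y, z, w} \<union> star x {y} \<union> star z (insert w C)"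
    using T by (simp_all add: two_triangles_def)
  have "card {u, x, y, z, w} = 5" using dist by simp
  then have "n = 5 + card C" unfolding n(1) V using C by (subst card_Un_disjoint) auto
  then have "card C = card {5..<n}" by simp
  then obtain g where g: "bij_betw g C {5..<n}" using finite_same_card_bij[OF C(1)] by blast
  \<comment> \<open>The five core vertices go to the arguments 0, 3, 4, 1, 2 of
    \<open>R_E_two_triangles\<close>, and the leaves follow any bijection.\<close>
  define f where "f v = (if v = u then 0 else if v = x then 3 else if v = y then 4
    else if v = z then 1 else if v = w then 2 else g v)" for v
  have fv: "f u = 0" "f x = 3" "f y = 4" "f z = 1" "f w = 2" using dist by (auto simp: f_def)
  have "bij_betw f C {5..<n}"
    using g by (rule bij_betw_cong[THEN iffD1, rotated]) (use C(2) in \<open>auto simp: f_def\<close>)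
  moreover have "bij_betw f {u, x, y, z, w} {0, 3, 4, 1, 2}"
    using dist fv by (auto simp: bij_betw_def inj_on_def)
  ultimately have "bij_betw f ({u, x, y, z, w} \<union> C) ({0, 3, 4, 1, 2} \<union> {5..<n})"
    by (intro bij_betw_combine) auto
  moreover have "{0, 3, 4, 1, 2} \<union> {5..<n} = {..<n}" using n(2) by auto
  ultimately have bij: "bij_betw f V (R_V n)" by (simp add: V R_V_def)
  have "f ` C = {5..<n}" using \<open>bij_betw f C {5..<n}\<close> by (simp add: bij_betw_def)
  \<comment> \<open>Both edge sets are unions of three stars, so comparing centres and leaf sets is
    enough. Injectivity of \<open>f\<close> on \<open>V\<close> then reflects edges as well.\<close>
  then have img: "R_E n = (`) f ` E"
    using R_E_two_triangles[OF n(2)] fv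
    unfolding E by (simp add: two_triangles_def image_Un image_star)
  have subV: "e \<subseteq> V" if "e \<in> E" for e using that unfolding E V by (auto simp: mem_star)
  have "{a, b} \<in> E \<longleftrightarrow> {f a, f b} \<in> R_E n" if ab: "a \<in> V" "b \<in> V" for a b
  proof
    assume "{a, b} \<in> E"
    then have "f ` {a, b} \<in> (`) f ` E" by blast
    then show "{f a, f b} \<in> R_E n" using img by simp
  next
    assume "{f a, f b} \<in> R_E n"
    then obtain e where e: "e \<in> E" "f ` {a, b} = f ` e" using img by auto
    have "{a, b} = e"
      using inj_on_image_eq_iff[of f V "{a, b}" e] bij subV[OF e(1)] e(2) ab by (simp add: bij_betw_def)
    then show "{a, b} \<in> E" using e(1) by simp
  qed
  then show ?thesis using bij unfolding graph_iso_def by blast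
qed

section \<open>Comparison with R_n(3,3), split by whether some \<open>G - u - v\<close> is a
  star\<close>

theorem theorem3p6:
  fixes V :: "'a set" and E :: "'a set set" and n :: nat
  assumes "simple_graph V E"
    and "connected_graph V E"
    and "n \<ge> 6"
    and "card V = n"
    and "card E = n + 1"
    and "\<exists>c1 c2. is_cycle E c1 \<and> is_cycle E c2 \<and> card (set c1 \<inter> set c2) = 1"
    and "\<not> graph_iso V E (R_V n) (R_E n)"
  shows "avm E > avm (R_E n)"
proof -
  let ?k = "real (n - 5)"
  have k: "?k > 0" using assms(3) by simp
  have sub: "e \<subseteq> V" and two: "card e = 2" if "e \<in> E" for e
    using assms(1) that by (auto simp: simple_graph_def)
  have finV: "finite V" using assms(1) by (simp add: simple_graph_def)
  have "finite E" by (rule finite_subset[of _ "Pow V"]) (use sub finV in auto)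
  then have es: "edge_set E" using two by (simp add: edge_set_def)
  have inc: "\<exists>x. {v, x} \<in> E" if v: "v \<in> V" for v
  proof -
    have "\<not> V \<subseteq> {v}" using assms(3,4) card_mono[of "{v}" V] by auto
    then obtain w where "w \<in> V" "v \<noteq> w" by blast
    then show ?thesis using connected_incident_edge[OF assms(2) v] by blast
  qed
  obtain c1 c2 where c: "is_cycle E c1" "is_cycle E c2" "card (set c1 \<inter> set c2) = 1" using assms(6) by blast
  then obtain u where u: "set c1 \<inter> set c2 = {u}" by (auto simp: card_1_singleton_iff)
  then have "u \<in> set c1" "u \<in> set c2" by auto
  obtain vs where vs: "ear E u vs" "set c1 = insert u (set vs)" using cycle_ear[OF c(1) \<open>u \<in> set c1\<close>] .
  obtain ws where ws: "ear E u ws" "set c2 = insert u (set ws)" using cycle_ear[OF c(2) \<open>u \<in> set c2\<close>] .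
  have "u \<notin> set vs" "u \<notin> set ws" using vs ws by (simp_all add: ear_def)
  moreover have "set vs \<inter> set ws \<subseteq> {u}" using u vs(2) ws(2) by blast
  ultimately have disj: "set vs \<inter> set ws = {}" by blast
  have cardE: "card E = card V + 1" using assms(4,5) by simp
  have ge2: "card M \<ge> 2" if "maximal_matching E M" for M
    by (rule two_ears_matching_ge_2[OF es vs(1) ws(1) disj that])
  have goal: "avm E > avm (R_E n)" if "mm_sum wt E \<ge> 0"
    using avm_gt[OF es k ge2 that] avm_R_E[OF assms(3)] by simp
  show ?thesis
  \<comment> \<open>The condition says that every edge of \<open>G - u - x\<close> contains
    \<open>z\<close>; an empty \<open>G - u - x\<close> is included.\<close>
  proof (cases "\<exists>x z. x \<in> nbrs E u \<and> (\<forall>e\<in>E. u \<in> e \<or> x \<in> e \<or> z \<in> e)")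
    case True
    then obtain x z where xz: "x \<in> nbrs E u" "\<And>e. e \<in> E \<Longrightarrow> u \<in> e \<or> x \<in> e \<or> z \<in> e" by blast
    consider (tri) y w A B C where "two_triangles u x y z w A B C E" "V = {u, x, y, z, w} \<union> A \<union> B \<union> C"
      | (sq) y w w' A B C where "triangle_square u x y z w w' A B C E"
      using two_star_structure[OF finV es sub inc cardE vs(1) ws(1) disj xz] by blast
    then show ?thesis
    proof cases
      case sq
      then show ?thesis by (intro goal triangle_square_wt_nonneg)
    next
      case tri
      have fin: "finite A" "finite B" "finite C" and dist: "distinct [u, x, y, z, w]"
        and dj: "{u, x, y, z, w} \<inter> (A \<union> B \<union> C) = {}" "A \<inter> B = {}" "A \<inter> C = {}" "B \<inter> C = {}"
        using tri(1) by (simp_all add: two_triangles_def)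
      show ?thesis
      proof (cases "B \<noteq> {} \<and> C \<noteq> {} \<or> A \<noteq> {} \<and> (B \<noteq> {} \<or> C \<noteq> {}) \<or> card A \<ge> 2")
        case True
        then show ?thesis using goal two_triangles_wt_nonneg[OF tri(1)] by blast
      next
        case False
        have "A \<noteq> {} \<or> B \<noteq> {} \<or> C \<noteq> {}"
        proof (rule ccontr)
          assume "\<not> ?thesis"
          then have "V = {u, x, y, z, w}" using tri(2) by simp
          then have "card V = 5" using dist by simp
          then show False using assms(3,4) by simp
        qed
        \<comment> \<open>What remains has leaves at only one of \<open>u\<close>, \<open>x\<close>,
          \<open>z\<close>. Leaves at \<open>x\<close> or at \<open>z\<close> give R_n(3,3) itself,
          which is excluded.\<close>
        then consider "A = {}" "B = {}" | "A = {}" "C = {}" | "A \<noteq> {}" "B = {}" "C = {}"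
          using False by blast
        then show ?thesis
        proof cases
          case 1
          then have "graph_iso V E (R_V n) (R_E n)"
            using two_triangles_iso_R[of u x y z w C E V n] tri assms(3,4) by simp
          then show ?thesis using assms(7) by simp
        next
          case 2
          have "two_triangles u z w x y {} {} B E" using two_triangles_swap[OF tri(1)] 2 by simp
          moreover have "V = {u, z, w, x, y} \<union> B" using tri(2) 2 by auto
          ultimately have "graph_iso V E (R_V n) (R_E n)"
            using two_triangles_iso_R[of u z w x y B E V n] assms(3,4) by simp
          then show ?thesis using assms(7) by simp
        next
          case 3
          then have A1: "card A = 1" using False fin(1) card_gt_0_iff[of A] by linarith
          then obtain l where l: "A = {l}" by (auto simp: card_1_singleton_iff)
          then have "card V = 6" unfolding tri(2) using 3 dist dj(1) by simp
          then have n: "n = 6" using assms(4) by simp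
          \<comment> \<open>The weight is -2 here, so the averages are compared directly: four
            maximal matchings of size 2 and one of size 3, against 15/7 for R_6(3,3).\<close>
          have "avm E = 11 / 5"
            unfolding avm_eq_mm_sum mm_sum_two_triangles[OF tri(1)] using 3 A1
            by (simp add: pair_val_def)
          then show ?thesis using avm_R_E[OF assms(3)] n by simp
        qed
      qed
    qed
  next
    case False
    \<comment> \<open>This one fact supplies two hypotheses of \<open>mm_sum_wt_nonneg\<close>: no
      \<open>G - u - v\<close> is empty and none is a star.\<close>
    have notbad: "\<exists>e\<in>avoid (avoid E u) v. z \<notin> e" if "v \<in> nbrs E u" for v z
      using False that unfolding avoid_def by blast
    have "{hd vs, last vs, hd ws, last ws} \<subseteq> nbrs E u"
      using vs(1) ws(1) by (auto simp: ear_def nbrs_def)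
    moreover have "card {hd vs, last vs, hd ws, last ws} = 4"
    proof -
      have "hd vs \<in> set vs" "last vs \<in> set vs" "hd ws \<in> set ws" "last ws \<in> set ws"
        using ear_hd_edge[OF vs(1)] ear_last_edge[OF vs(1)] ear_hd_edge[OF ws(1)] ear_last_edge[OF ws(1)]
        by metis+
      then have "hd vs \<noteq> hd ws" "hd vs \<noteq> last ws" "last vs \<noteq> hd ws" "last vs \<noteq> last ws"
        using disj by auto
      then show ?thesis using ear_hd_neq_last[OF vs(1)] ear_hd_neq_last[OF ws(1)] by simp
    qed
    ultimately have "card (nbrs E u) \<ge> 4" using card_mono[OF finite_nbrs[OF es]] by metis
    then have "mm_sum wt E \<ge> 0"
    proof (rule mm_sum_wt_nonneg[OF es])
      fix a b c
      assume "{a, b} \<in> avoid E u" "{b, c} \<in> avoid E u" "{a, c} \<in> avoid E u"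
      then show False
        by (intro no_triangle_avoiding[OF assms(1,2) cardE vs(1) ws(1) disj, of a b c]) (auto simp: avoid_def)
    qed (use notbad in blast)+
    then show ?thesis by (rule goal)
  qed
qed

end
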